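(* Let $n\ge 3$, let $\mathbb{M}^n$ be a Cartan-Hadamard model manifold associated to a function $\psi$, and let $p,q>0$ satisfy $\frac{1}{p+1}+\frac{1}{q+1}\le\frac{n-2}{n}$. Then for each $\xi>0$ there exists at least one value $\eta\equiv\eta(\xi)>0$ such that $(\xi,\eta)$ gives rise to a globally positive solution of $CP(\xi,\eta)$. In particular, the Lane-Emden system $-\Delta u=v^q$, $-\Delta v=u^p$, $u,v>0$ on $\mathbb{M}^n$ has at least a $1$-parameter family of solutions (parametrized by $\xi=u(o)>0$, $o$ being the pole).
   Context: A (noncompact) model manifold $\mathbb{M}^n$ associated to $\psi$ is a Riemannian manifold whose metric, in global polar coordinates $(r,\vartheta)\in\mathbb{R}^+\times\mathbb{S}^{n-1}$ about a pole $o$, is $g=dr\otimes dr+\psi^2(r)\,g_{\mathbb{S}^{n-1}}$, where $\psi\in C^1([0,+\infty))\cap C^\infty((0,+\infty))$, $\psi>0$ on $(0,+\infty)$, $\psi(0)=0$, $\psi'(0)=1$. It is Cartan-Hadamard if and only if $\psi$ is in addition convex. For $(\xi,\eta)\in(0,+\infty)^2$, $CP(\xi,\eta)$ denotes the Cauchy problem for functions $u,v$ of $r$ (of class $C^1$ up to $r=0$ and $C^2$ for $r>0$) $$(\psi^{n-1}u')'+\psi^{n-1}|v|^{q-1}v=0,\quad (\psi^{n-1}v')'+\psi^{n-1}|u|^{p-1}u=0\ \ (r>0),\quad u'(0)=v'(0)=0,\ u(0)=\xi,\ v(0)=\eta.$$ A globally positive solution is a solution defined for every $r>0$ with $u,v>0$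 on $[0,+\infty)$; any such solution is a radial solution of the Lane-Emden system on $\mathbb{M}^n$. *)

theory Defs
  imports "HOL-Analysis.Analysis"
begin

section \<open>Model manifolds\<close>

definition C1_halfline :: "(real \<Rightarrow> real) \<Rightarrow> (real \<Rightarrow> real) \<Rightarrow> bool" where
  "C1_halfline f f' \<longleftrightarrow>
     (\<forall>r\<ge>0. (f has_real_derivative f' r) (at r within {0..})) \<and> continuous_on {0..} f'"

text \<open>Only the values on \<open>[0,\<infinity>)\<close> matter; all derivatives at \<open>0\<close> are one-sided.\<close>

definition model_function :: "(real \<Rightarrow> real) \<Rightarrow> bool" where
  "model_function \<psi> \<longleftrightarrow>
     (\<exists>\<psi>'. C1_halfline \<psi> \<psi>' \<and> \<psi>' 0 = 1) \<and>
     (\<forall>k. \<forall>r>0. ((deriv ^^ k) \<psi>) differentiable (at r)) \<and>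
     (\<forall>r>0. \<psi> r > 0) \<and> \<psi> 0 = 0"

text \<open>The Cartan-Hadamard property of the model manifold associated to \<open>\<psi>\<close>, expressed on \<open>\<psi>\<close>:
  the model manifold is Cartan-Hadamard if and only if \<open>\<psi>\<close> is, in addition, convex.\<close>

definition Cartan_Hadamard_model :: "(real \<Rightarrow> real) \<Rightarrow> bool" where
  "Cartan_Hadamard_model \<psi> \<longleftrightarrow> model_function \<psi> \<and> convex_on {0..} \<psi>"

text \<open>The model manifold is \<open>\<real>\<^sup>n\<close> with pole \<open>0\<close>, the point with polar coordinates \<open>(r, \<theta>)\<close> being
  \<open>r \<theta>\<close>. In Cartesian coordinates \<open>dr \<otimes> dr\<close> has matrix \<open>x x\<^sup>T / r\<^sup>2\<close> and the round metric
  \<open>r\<^sup>2 g\<^sub>S\<close> has matrix \<open>I - x x\<^sup>T / r\<^sup>2\<close>, where \<open>r = |x|\<close>. The value at the pole is the continuous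
  extension, since \<open>\<psi> r / r\<close> tends to \<open>\<psi>' 0 = 1\<close>.\<close>

definition model_metric :: "(real \<Rightarrow> real) \<Rightarrow> real^'n \<Rightarrow> real^'n^'n" where
  "model_metric \<psi> x =
     (if x = 0 then mat 1
      else (\<chi> i j. x $ i * x $ j / (norm x)\<^sup>2
             + (\<psi> (norm x) / norm x)\<^sup>2 * ((if i = j then 1 else 0) - x $ i * x $ j / (norm x)\<^sup>2)))"

section \<open>The Laplace-Beltrami operator in global coordinates\<close>

definition partial_deriv :: "'n \<Rightarrow> (real^'n \<Rightarrow> real) \<Rightarrow> real^'n \<Rightarrow> real" where
  "partial_deriv i f x = frechet_derivative f (at x) (axis i 1)"

definition C1_function :: "(real^'n \<Rightarrow> real) \<Rightarrow> bool" where
  "C1_function f \<longleftrightarrow>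
     (\<forall>x. f differentiable (at x)) \<and> (\<forall>i. continuous_on UNIV (partial_deriv i f))"

definition C2_function :: "(real^'n \<Rightarrow> real) \<Rightarrow> bool" where
  "C2_function f \<longleftrightarrow> C1_function f \<and> (\<forall>i. C1_function (partial_deriv i f))"

text \<open>The density-weighted Riemannian gradient \<open>\<surd>(det g) \<Sum>\<^sub>j g\<^sup>i\<^sup>j \<partial>\<^sub>j f\<close>.\<close>

definition gradient_flux :: "(real^'n \<Rightarrow> real^'n^'n) \<Rightarrow> (real^'n \<Rightarrow> real) \<Rightarrow> real^'n \<Rightarrow> real^'n" where
  "gradient_flux g f x =
     sqrt (det (g x)) *\<^sub>R (matrix_inv (g x) *v (\<chi> j. partial_deriv j f x))"

definition Laplace_Beltrami :: "(real^'n \<Rightarrow> real^'n^'n) \<Rightarrow> (real^'n \<Rightarrow> real) \<Rightarrow> real^'n \<Rightarrow> real" where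
  "Laplace_Beltrami g f x =
     1 / sqrt (det (g x)) * (\<Sum>i\<in>UNIV. partial_deriv i (\<lambda>y. gradient_flux g f y $ i) x)"

text \<open>Classical solutions. The metric is smooth away from the pole but, as \<open>\<psi>\<close> is only \<open>C\<^sup>1\<close> up to
  \<open>0\<close>, merely continuous at the pole. That the flux is \<open>C\<^sup>1\<close> is therefore required separately: it
  makes the divergence in the Laplace-Beltrami operator exist (and be continuous) at the pole too,
  whereas elsewhere it already follows from \<open>f\<close> being \<open>C\<^sup>2\<close>.\<close>

definition classical_domain :: "(real^'n \<Rightarrow> real^'n^'n) \<Rightarrow> (real^'n \<Rightarrow> real) \<Rightarrow> bool" where
  "classical_domain g f \<longleftrightarrow>
     C2_function f \<and> (\<forall>i. C1_function (\<lambda>y. gradient_flux g f y $ i))"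

definition Lane_Emden_solution ::
    "(real^'n \<Rightarrow> real^'n^'n) \<Rightarrow> real \<Rightarrow> real \<Rightarrow> (real^'n \<Rightarrow> real) \<Rightarrow> (real^'n \<Rightarrow> real) \<Rightarrow> bool" where
  "Lane_Emden_solution g p q u v \<longleftrightarrow>
     classical_domain g u \<and> classical_domain g v \<and>
     (\<forall>x. u x > 0 \<and> v x > 0 \<and>
          - Laplace_Beltrami g u x = v x powr q \<and>
          - Laplace_Beltrami g v x = u x powr p)"

section \<open>The radial Cauchy problem\<close>

text \<open>Solutions defined on the whole of \<open>[0,\<infinity>)\<close>. Since \<open>0 powr a = 0\<close>, the term
  \<open>\<bar>v\<bar> powr (q - 1) * v\<close> vanishes where \<open>v\<close> does, as it should, for every \<open>q > 0\<close>.\<close>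

definition CP_global_solution ::
    "nat \<Rightarrow> (real \<Rightarrow> real) \<Rightarrow> real \<Rightarrow> real \<Rightarrow> real \<Rightarrow> real \<Rightarrow> (real \<Rightarrow> real) \<Rightarrow> (real \<Rightarrow> real) \<Rightarrow> bool" where
  "CP_global_solution n \<psi> p q \<xi> \<eta> u v \<longleftrightarrow>
     (\<exists>u' v' u'' v''.
        C1_halfline u u' \<and> C1_halfline v v' \<and>
        (\<forall>r>0. (u' has_real_derivative u'' r) (at r)) \<and> continuous_on {0<..} u'' \<and>
        (\<forall>r>0. (v' has_real_derivative v'' r) (at r)) \<and> continuous_on {0<..} v'' \<and>
        (\<forall>r>0. ((\<lambda>s. \<psi> s ^ (n - 1) * u' s) has_real_derivative
                 - (\<psi> r ^ (n - 1) * (\<bar>v r\<bar> powr (q - 1) * v r))) (at r)) \<and>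
        (\<forall>r>0. ((\<lambda>s. \<psi> s ^ (n - 1) * v' s) has_real_derivative
                 - (\<psi> r ^ (n - 1) * (\<bar>u r\<bar> powr (p - 1) * u r))) (at r)) \<and>
        u' 0 = 0 \<and> v' 0 = 0 \<and> u 0 = \<xi> \<and> v 0 = \<eta>)"

definition globally_positive_solution ::
    "nat \<Rightarrow> (real \<Rightarrow> real) \<Rightarrow> real \<Rightarrow> real \<Rightarrow> real \<Rightarrow> real \<Rightarrow> (real \<Rightarrow> real) \<Rightarrow> (real \<Rightarrow> real) \<Rightarrow> bool" where
  "globally_positive_solution n \<psi> p q \<xi> \<eta> u v \<longleftrightarrow>
     CP_global_solution n \<psi> p q \<xi> \<eta> u v \<and> (\<forall>r\<ge>0. u r > 0 \<and> v r > 0)"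

end

theory Submission
  imports Defs
begin

text \<open>Idea. Replace the nonlinearities by powers of positive parts. The resulting map
  \<open>v \<mapsto> \<eta> - pot ((\<xi> - pot (v\<^sub>+\<^sup>q))\<^sub>+\<^sup>p)\<close> is order preserving, so iterating it from the constant \<open>\<eta>\<close>
  yields a global solution that depends monotonically on \<open>\<eta>\<close>. For small \<open>\<eta>\<close> the component \<open>v\<close> vanishes
  first, for large \<open>\<eta>\<close> the component \<open>u\<close> does. At the supremum \<open>\<eta>\<close> of the former values the limit from
  the left still loses \<open>v\<close> first and the limit from the right still loses \<open>u\<close> first, which contradicts
  uniqueness as long as both components are positive. Hence some solution is globally positive, unless
  both components vanish at the same radius \<open>R\<close>, and this is excluded by a Pohozaev identity: for the
  volume \<open>V\<close> of geodesic balls and their boundary area \<open>w = \<psi>\<^sup>n\<^sup>-\<^sup>1\<close> (up to a common factor),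
  \<open>P = V (u\<^sup>p\<^sup>+\<^sup>1/(p+1) + v\<^sup>q\<^sup>+\<^sup>1/(q+1) + u'v') + w (u'v/(q+1) + u v'/(p+1))\<close> satisfies \<open>P 0 = 0 < P R\<close>,
  while \<open>P'\<close> is \<open>u'v'\<close> times a factor that is nonpositive because convexity of \<open>\<psi>\<close> gives
  \<open>\<psi>\<^sup>n \<le> n \<psi>' V\<close>.\<close>

section \<open>Radial potentials\<close>

lemma integral_halfline_has_derivative:
  fixes f :: "real \<Rightarrow> real"
  assumes "continuous_on {0..} f" and "0 \<le> r"
  shows "((\<lambda>s. integral {0..s} f) has_real_derivative f r) (at r within {0..})"
proof -
  have "((\<lambda>s. integral {0..s} f) has_real_derivative f r) (at r within {0..r+1})"
    using assms by (intro integral_has_real_derivative continuous_on_subset[OF assms(1)]) auto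
  moreover have "at r within {0..r+1} = at r within {0..}"
    by (rule at_within_nhd[of _ "{..<r+1}"]) auto
  ultimately show ?thesis by simp
qed

lemma integrable_halfline:
  fixes f :: "real \<Rightarrow> real"
  assumes "continuous_on {0..} f" and "0 \<le> a"
  shows "f integrable_on {a..r}"
  using assms by (intro integrable_continuous_interval continuous_on_subset[OF assms(1)]) auto

lemma at_within_halfline: "0 < (r::real) \<Longrightarrow> at r within {0..} = at r"
  by (rule at_within_interior) (auto simp: interior_Ici)

lemma has_derivative_imp_continuous_on_halfline:
  fixes f :: "real \<Rightarrow> real"
  assumes "\<And>r. 0 \<le> r \<Longrightarrow> (f has_real_derivative f' r) (at r within {0..})"
  shows "continuous_on {0..} f"
  using assms by (intro DERIV_continuous_on[of _ f f']) auto

lemma continuous_halfline_near: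
  assumes "continuous_on {0..} f" "0 \<le> (R::real)" "f R < (a::real)"
  obtains d where "0 < d" "\<And>s. 0 \<le> s \<Longrightarrow> \<bar>s - R\<bar> < d \<Longrightarrow> f s < a"
proof -
  obtain d where "0 < d" and d: "\<And>s. 0 \<le> s \<Longrightarrow> dist s R < d \<Longrightarrow> dist (f s) (f R) < a - f R"
    using assms continuous_on_iff[of "{0..}" f] by (metis atLeast_iff diff_gt_0_iff_gt)
  show thesis
  proof
    show "0 < d" by fact
    show "f s < a" if "0 \<le> s" "\<bar>s - R\<bar> < d" for s
      using d[of s] that by (auto simp: dist_real_def)
  qed
qed

lemma halfline_tendsto_right:
  assumes "continuous_on {0..} (h :: real \<Rightarrow> real)"
  shows "(h \<longlongrightarrow> h 0) (at_right 0)"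
  by (rule tendsto_within_subset[of _ _ _ "{0..}"]) (use assms in \<open>auto simp: continuous_on_def\<close>)

lemma halfline_continuous_open:
  "continuous_on {0..} (h :: real \<Rightarrow> real) \<Longrightarrow> continuous_on {0<..} h"
  by (erule continuous_on_subset) auto

text \<open>The truncated power is nonnegative and nondecreasing on the whole line, so solutions can
  be continued past a zero of a component. For \<open>x > 0\<close> it agrees with
  \<open>\<bar>x\<bar> powr (a - 1) * x\<close>.\<close>

definition pos_powr :: "real \<Rightarrow> real \<Rightarrow> real" where
  "pos_powr a x = max x 0 powr a"

lemma pos_powr_nonneg: "0 \<le> pos_powr a x"
  by (simp add: pos_powr_def)

lemma pos_powr_mono: "0 < a \<Longrightarrow> x \<le> y \<Longrightarrow> pos_powr a x \<le> pos_powr a y"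
  unfolding pos_powr_def by (intro powr_mono2) auto

lemma continuous_on_pos_powr:
  assumes "0 < a" "continuous_on S f"
  shows "continuous_on S (\<lambda>x. pos_powr a (f x))"
  unfolding pos_powr_def using assms by (intro continuous_on_powr' continuous_intros) auto

lemma tendsto_pos_powr:
  assumes "0 < a" "(f \<longlongrightarrow> l) F"
  shows "((\<lambda>x. pos_powr a (f x)) \<longlongrightarrow> pos_powr a l) F"
  unfolding pos_powr_def using assms by (intro tendsto_powr' tendsto_intros) auto

text \<open>For \<open>a < 1\<close> the power is not Lipschitz near \<open>0\<close>, hence the
  lower bound \<open>d\<close>; on \<open>{d..M}\<close> its derivative is bounded by
  compactness.\<close>

lemma pos_powr_Lipschitz:
  assumes "0 < d" "0 < a"
  obtains L where "0 \<le> L"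
    "\<And>x y. d \<le> x \<Longrightarrow> x \<le> M \<Longrightarrow> d \<le> y \<Longrightarrow> y \<le> M \<Longrightarrow> \<bar>pos_powr a x - pos_powr a y\<bar> \<le> L * \<bar>x - y\<bar>"
proof -
  have "continuous_on {d..M} (\<lambda>z. a * z powr (a - 1))"
    using assms by (intro continuous_intros) auto
  then obtain L where L: "0 \<le> L" "\<And>z. z \<in> {d..M} \<Longrightarrow> norm (a * z powr (a - 1)) \<le> L"
    using continuous_on_compact_bound[OF compact_Icc] by blast
  show thesis
  proof
    show "0 \<le> L" by (rule L)
    fix x y :: real assume xy: "d \<le> x" "x \<le> M" "d \<le> y" "y \<le> M"
    have "norm (x powr a - y powr a) \<le> L * norm (x - y)"
    proof (rule field_differentiable_bound[where S = "{d..M}"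
          and f = "\<lambda>z. z powr a" and f' = "\<lambda>z. a * z powr (a - 1)"])
      show "((\<lambda>z. z powr a) has_field_derivative a * z powr (a - 1)) (at z within {d..M})"
        if "z \<in> {d..M}" for z
        using that assms has_field_derivative_at_within[OF has_real_derivative_powr] by auto
      show "norm (a * z powr (a - 1)) \<le> L" if "z \<in> {d..M}" for z
        using L(2)[OF that] .
    qed (use xy in auto)
    then show "\<bar>pos_powr a x - pos_powr a y\<bar> \<le> L * \<bar>x - y\<bar>"
      using xy assms by (simp add: pos_powr_def max_def)
  qed
qed

text \<open>Abstract form of the area density \<open>\<psi> ^ (n - 1)\<close>. Existence, monotone
  dependence and shooting use no more geometry than this; monotonicity of \<open>w\<close> is what
  controls averages near its zero at the pole.\<close>

locale radial_weight =
  fixes w :: "real \<Rightarrow> real"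
  assumes w_continuous: "continuous_on {0..} w"
    and w_0: "w 0 = 0"
    and w_pos: "0 < r \<Longrightarrow> 0 < w r"
    and w_mono: "0 \<le> r \<Longrightarrow> r \<le> s \<Longrightarrow> w r \<le> w s"
begin

definition wint :: "(real \<Rightarrow> real) \<Rightarrow> real \<Rightarrow> real" where
  "wint f r = integral {0..r} (\<lambda>t. w t * f t)"

text \<open>The value at \<open>0\<close> is \<open>0\<close> because \<open>w 0 = 0\<close> and division by \<open>0\<close> yields \<open>0\<close>; this makes \<open>wavg f\<close>
  continuous on \<open>[0,\<infinity>)\<close>.\<close>

definition wavg :: "(real \<Rightarrow> real) \<Rightarrow> real \<Rightarrow> real" where
  "wavg f r = wint f r / w r"

text \<open>Inverse of the radial operator: for continuous \<open>f\<close>, the function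
  \<open>u = c - pot f\<close> solves \<open>(w u')' = - w f\<close> with \<open>u 0 = c\<close> and
  \<open>u' 0 = 0\<close>. Here \<open>wavg f\<close> is \<open>- u'\<close> and
  \<open>wint f\<close> is \<open>- w u'\<close>.\<close>

definition pot :: "(real \<Rightarrow> real) \<Rightarrow> real \<Rightarrow> real" where
  "pot f r = integral {0..r} (wavg f)"

section \<open>Bounds and regularity of weighted averages and potentials\<close>

lemma w_nonneg: "0 \<le> r \<Longrightarrow> 0 \<le> w r"
  using w_pos[of r] w_0 by (cases "r = 0") auto

lemma wf_continuous:
  "continuous_on {0..} f \<Longrightarrow> continuous_on {0..} (\<lambda>t. w t * f t)"
  using w_continuous by (intro continuous_intros)

lemma wf_integrable:
  "continuous_on {0..} f \<Longrightarrow> (\<lambda>t. w t * f t) integrable_on {0..r}"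
  by (rule integrable_halfline[OF wf_continuous]) auto

lemma wint_0: "wint f 0 = 0" and wavg_0: "wavg f 0 = 0" and pot_0: "pot f 0 = 0"
  by (simp_all add: wint_def wavg_def pot_def)

lemma wint_has_derivative:
  assumes "continuous_on {0..} f" "0 \<le> r"
  shows "(wint f has_real_derivative w r * f r) (at r within {0..})"
  unfolding wint_def[abs_def]
  using integral_halfline_has_derivative[OF wf_continuous[OF assms(1)] assms(2)] .

lemma wint_continuous:
  assumes "continuous_on {0..} f"
  shows "continuous_on {0..} (wint f)"
  by (rule has_derivative_imp_continuous_on_halfline, rule wint_has_derivative[OF assms])

text \<open>Bounding \<open>w t\<close> by \<open>w r\<close> under the integral makes the weight
  cancel on division, so averages of bounded functions are of order \<open>r\<close> however fast
  \<open>w\<close> vanishes at \<open>0\<close>.\<close>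

lemma wint_const_le:
  assumes "0 \<le> r" "0 \<le> c"
  shows "wint (\<lambda>_. c) r \<le> c * (w r * r)"
proof -
  have "wint (\<lambda>_. c) r \<le> integral {0..r} (\<lambda>_. w r * c)"
    unfolding wint_def using assms w_mono
    by (intro integral_le wf_integrable) (auto intro: mult_right_mono)
  then show ?thesis using assms by (simp add: mult_ac)
qed

lemma wint_mono:
  assumes "continuous_on {0..} f" "continuous_on {0..} g"
    and "\<And>t. 0 \<le> t \<Longrightarrow> t \<le> r \<Longrightarrow> f t \<le> g t"
  shows "wint f r \<le> wint g r"
  unfolding wint_def using assms w_nonneg
  by (intro integral_le wf_integrable) (auto intro: mult_left_mono)

lemma wavg_mono:
  assumes "continuous_on {0..} f" "continuous_on {0..} g" "0 \<le> r"
    and "\<And>t. 0 \<le> t \<Longrightarrow> t \<le> r \<Longrightarrow> f t \<le> g t"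
  shows "wavg f r \<le> wavg g r"
  unfolding wavg_def using assms by (intro divide_right_mono wint_mono w_nonneg) auto

lemma wavg_const_le:
  assumes "0 \<le> r" "0 \<le> c"
  shows "wavg (\<lambda>_. c) r \<le> c * r"
proof (cases "r = 0")
  case False
  then show ?thesis
    using wint_const_le[OF assms] w_pos[of r] assms by (simp add: wavg_def field_simps)
qed (simp add: wavg_0)

lemma wavg_le:
  assumes "continuous_on {0..} f" "0 \<le> r" "0 \<le> c"
    and "\<And>t. 0 \<le> t \<Longrightarrow> t \<le> r \<Longrightarrow> f t \<le> c"
  shows "wavg f r \<le> c * r"
  using wavg_mono[of f "\<lambda>_. c" r] wavg_const_le[of r c] assms by (auto intro: order_trans)

lemma wavg_uminus: "wavg (\<lambda>t. - f t) r = - wavg f r"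
  by (simp add: wavg_def wint_def)

lemma abs_wavg_le:
  assumes "continuous_on {0..} f" "0 \<le> r" "0 \<le> c"
    and "\<And>t. 0 \<le> t \<Longrightarrow> t \<le> r \<Longrightarrow> \<bar>f t\<bar> \<le> c"
  shows "\<bar>wavg f r\<bar> \<le> c * r"
proof -
  have "wavg f r \<le> c * r" using assms by (intro wavg_le) (auto simp: abs_le_iff)
  moreover have "wavg (\<lambda>t. - f t) r \<le> c * r"
    using assms by (intro wavg_le continuous_intros) (auto simp: abs_le_iff)
  ultimately show ?thesis by (simp add: wavg_uminus)
qed

lemma wavg_nonneg:
  assumes "continuous_on {0..} f" "0 \<le> r" "\<And>t. 0 \<le> t \<Longrightarrow> t \<le> r \<Longrightarrow> 0 \<le> f t"
  shows "0 \<le> wavg f r"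
  using wavg_mono[of "\<lambda>_. 0" f r] assms by (simp add: wavg_def wint_def)

text \<open>A nonnegative continuous integrand with zero integral would vanish on all of
  \<open>{0..r}\<close>, but close to the pole \<open>f\<close> is positive by continuity, and
  \<open>w\<close> is positive off the pole.\<close>

lemma wavg_pos:
  assumes "continuous_on {0..} f" "0 < r" "\<And>t. 0 \<le> t \<Longrightarrow> t \<le> r \<Longrightarrow> 0 \<le> f t" "0 < f 0"
  shows "0 < wavg f r"
proof -
  have "0 \<le> wint f r"
    using wint_mono[of "\<lambda>_. 0" f r] assms by (simp add: wint_def)
  moreover have "wint f r \<noteq> 0"
  proof
    assume "wint f r = 0"
    moreover have "((\<lambda>t. w t * f t) has_integral wint f r) {0..r}"
      unfolding wint_def using wf_integrable[OF assms(1)] by (rule integrable_integral)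
    ultimately have "((\<lambda>t. w t * f t) has_integral 0) (cbox 0 r)" by simp
    moreover have "continuous_on (cbox 0 r) (\<lambda>t. w t * f t)"
      by (rule continuous_on_subset[OF wf_continuous[OF assms(1)]]) auto
    ultimately have zero: "w t * f t = 0" if "t \<in> cbox 0 r" for t
      using assms(2,3) w_nonneg that by (intro has_integral_0_cbox_imp_0[of 0 r _ t]) auto
    have "(f \<longlongrightarrow> f 0) (at 0 within {0..})"
      using assms(1) by (simp add: continuous_on_def)
    then have "eventually (\<lambda>t. 0 < f t) (at 0 within {0..})"
      using assms(4) by (rule order_tendstoD)
    then obtain d where "d > 0" and d: "\<And>t. 0 < t \<Longrightarrow> t < d \<Longrightarrow> 0 < f t"
      unfolding eventually_at by (auto simp: dist_real_def)
    define t where "t = min r (d/2)"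
    have "0 < t" "t < d" "t \<le> r" using \<open>d > 0\<close> assms by (auto simp: t_def)
    then show False using zero[of t] d[of t] w_pos[of t] by simp
  qed
  ultimately show ?thesis using w_pos[OF assms(2)] by (simp add: wavg_def)
qed

text \<open>Away from the pole this is a quotient of continuous functions. At the pole, a bound
  \<open>c\<close> for \<open>f\<close> on \<open>{0..1}\<close> gives
  \<open>\<bar>wavg f s\<bar> \<le> c * s\<close>.\<close>

lemma wavg_continuous:
  assumes f: "continuous_on {0..} f"
  shows "continuous_on {0..} (wavg f)"
  unfolding continuous_on_def
proof
  fix r :: real assume "r \<in> {0..}"
  then consider "r = 0" | "0 < r" by force
  then show "(wavg f \<longlongrightarrow> wavg f r) (at r within {0..})"
  proof cases
    case 1
    have "continuous_on {0..1} f"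
      by (rule continuous_on_subset[OF f]) auto
    then obtain c where "0 \<le> c" and c: "\<And>t. t \<in> {0..1} \<Longrightarrow> norm (f t) \<le> c"
      using continuous_on_compact_bound[OF compact_Icc] by blast
    have "eventually (\<lambda>s. norm (wavg f s) \<le> c * s) (at 0 within {0..})"
      unfolding eventually_at
      using \<open>0 \<le> c\<close> by (intro exI[of _ 1]) (auto intro!: abs_wavg_le f c[unfolded real_norm_def] simp: dist_real_def)
    moreover have "((\<lambda>s. c * s) \<longlongrightarrow> 0) (at 0 within {0..})"
      by (auto intro!: tendsto_eq_intros)
    ultimately show ?thesis
      unfolding 1 wavg_0 by (rule Lim_null_comparison)
  next
    case 2
    then show ?thesis
      unfolding wavg_def[abs_def] using wint_continuous[OF f] w_continuous w_pos[OF 2]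
      by (intro tendsto_divide) (auto simp: continuous_on_def)
  qed
qed

lemma pot_has_derivative:
  assumes "continuous_on {0..} f" "0 \<le> r"
  shows "(pot f has_real_derivative wavg f r) (at r within {0..})"
  unfolding pot_def[abs_def]
  using integral_halfline_has_derivative[OF wavg_continuous[OF assms(1)] assms(2)] .

lemma pot_continuous: "continuous_on {0..} f \<Longrightarrow> continuous_on {0..} (pot f)"
  by (rule has_derivative_imp_continuous_on_halfline, rule pot_has_derivative)

lemma wavg_integrable: "continuous_on {0..} f \<Longrightarrow> wavg f integrable_on {0..r}"
  by (rule integrable_halfline[OF wavg_continuous]) auto

lemma pot_mono:
  assumes "continuous_on {0..} f" "continuous_on {0..} g"
    and "\<And>t. 0 \<le> t \<Longrightarrow> t \<le> r \<Longrightarrow> f t \<le> g t"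
  shows "pot f r \<le> pot g r"
  unfolding pot_def using assms
  by (intro integral_le wavg_integrable) (auto intro!: wavg_mono)

lemma pot_nonneg:
  assumes "continuous_on {0..} f" "\<And>t. 0 \<le> t \<Longrightarrow> t \<le> r \<Longrightarrow> 0 \<le> f t"
  shows "0 \<le> pot f r"
  unfolding pot_def using assms
  by (intro integral_nonneg wavg_integrable) (auto intro!: wavg_nonneg)

lemma pot_le:
  assumes "continuous_on {0..} f" "0 \<le> r" "0 \<le> c"
    and "\<And>t. 0 \<le> t \<Longrightarrow> t \<le> r \<Longrightarrow> f t \<le> c"
  shows "pot f r \<le> c * r\<^sup>2"
proof -
  have "pot f r \<le> integral {0..r} (\<lambda>_. c * r)"
    unfolding pot_def
  proof (intro integral_le wavg_integrable assms)
    fix s assume "s \<in> {0..r}"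
    then have "wavg f s \<le> c * s" "c * s \<le> c * r"
      using assms by (auto intro!: wavg_le mult_left_mono)
    then show "wavg f s \<le> c * r" by simp
  qed auto
  then show ?thesis using assms by (simp add: power2_eq_square mult_ac)
qed

lemma pot_cmult: "pot (\<lambda>t. c * f t) r = c * pot f r"
proof -
  have "wavg (\<lambda>t. c * f t) = (\<lambda>s. c * wavg f s)"
    by (simp add: wavg_def wint_def fun_eq_iff mult.left_commute[of _ c])
  then show ?thesis by (simp add: pot_def)
qed

lemma pot_add:
  assumes "continuous_on {0..} f" "continuous_on {0..} g"
  shows "pot (\<lambda>t. f t + g t) r = pot f r + pot g r"
proof -
  have "wavg (\<lambda>t. f t + g t) = (\<lambda>s. wavg f s + wavg g s)"
    using wf_integrable[OF assms(1)] wf_integrable[OF assms(2)]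
    by (simp add: wavg_def wint_def fun_eq_iff distrib_left integral_add add_divide_distrib)
  then show ?thesis
    using assms by (simp add: pot_def integral_add wavg_integrable)
qed

text \<open>Monotonicity of \<open>w\<close> removes the weight from the average. The result is a
  single unweighted integral, the form needed for Gronwall's argument.\<close>

lemma pot_le_integral:
  assumes f: "continuous_on {0..} f" and "0 \<le> r" and nonneg: "\<And>t. 0 \<le> t \<Longrightarrow> 0 \<le> f t"
  shows "pot f r \<le> r * integral {0..r} f"
proof -
  have "wavg f s \<le> integral {0..r} f" if s: "0 \<le> s" "s \<le> r" for s
  proof (cases "s = 0")
    case True
    then show ?thesis
      using integral_nonneg[OF integrable_halfline[OF f order_refl], of r] nonneg
      by (simp add: wavg_0)
  next
    case False
    have "wint f s \<le> integral {0..s} (\<lambda>t. w s * f t)"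
      unfolding wint_def using s w_mono nonneg
      by (intro integral_le wf_integrable f integrable_halfline[of "\<lambda>t. w s * f t"] continuous_intros)
         (auto intro: mult_right_mono)
    then have "wavg f s \<le> integral {0..s} f"
      using w_pos[of s] s False by (simp add: wavg_def field_simps)
    also have "\<dots> \<le> integral {0..r} f"
      using s nonneg by (intro integral_subset_le integrable_halfline[OF f]) auto
    finally show ?thesis .
  qed
  then have "pot f r \<le> integral {0..r} (\<lambda>_. integral {0..r} f)"
    unfolding pot_def by (intro integral_le wavg_integrable f) auto
  then show ?thesis using assms by (simp add: mult_ac)
qed

text \<open>Dominated convergence is applied twice, to \<open>wint\<close> and then to the integral
  of \<open>wavg\<close>. The limit \<open>g\<close> need not be continuous, so continuity of
  \<open>pot g\<close> comes from its being an indefinite integral.\<close>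

lemma pot_tendsto:
  assumes f: "\<And>k. continuous_on {0..} (f k)"
    and bounds: "\<And>k r. 0 \<le> r \<Longrightarrow> 0 \<le> f k r" "\<And>k r. 0 \<le> r \<Longrightarrow> f k r \<le> c"
    and lim: "\<And>r. 0 \<le> r \<Longrightarrow> (\<lambda>k. f k r) \<longlonglongrightarrow> g r"
  shows "0 \<le> r \<Longrightarrow> (\<lambda>k. pot (f k) r) \<longlonglongrightarrow> pot g r" and "continuous_on {0..} (pot g)"
proof -
  have "0 \<le> c" using bounds(1)[of 0 0] bounds(2)[of 0 0] by simp
  have wavg_lim: "(\<lambda>k. wavg (f k) s) \<longlonglongrightarrow> wavg g s" if "0 \<le> s" for s
  proof -
    have "(\<lambda>k. wint (f k) s) \<longlonglongrightarrow> wint g s"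
      unfolding wint_def
    proof (rule dominated_convergence)
      show "(\<lambda>t. w t * c) integrable_on {0..s}" by (intro wf_integrable continuous_intros)
      show "(\<lambda>t. w t * f k t) integrable_on {0..s}" for k by (intro wf_integrable f)
      show "norm (w t * f k t) \<le> w t * c" if "t \<in> {0..s}" for k t
        using bounds[of t k] that w_nonneg[of t] by (auto simp: abs_mult intro: mult_left_mono)
      show "(\<lambda>k. w t * f k t) \<longlonglongrightarrow> w t * g t" if "t \<in> {0..s}" for t
        using that by (intro tendsto_intros lim) auto
    qed
    then show ?thesis
    proof (cases "s = 0")
      case False
      then show ?thesis
        unfolding wavg_def using w_pos[of s] that \<open>(\<lambda>k. wint (f k) s) \<longlonglongrightarrow> wint g s\<close>
        by (intro tendsto_divide) auto
    qed (simp add: wavg_0)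
  qed
  have le: "norm (wavg (f k) s) \<le> c * s" if "0 \<le> s" for k s
    using bounds \<open>0 \<le> c\<close> that unfolding real_norm_def by (intro abs_wavg_le f) auto
  have *: "wavg g integrable_on {0..r}" "(\<lambda>k. pot (f k) r) \<longlonglongrightarrow> pot g r" for r
  proof -
    have h: "(\<lambda>s. c * s) integrable_on {0..r}"
      by (intro integrable_continuous_interval continuous_intros)
    show "wavg g integrable_on {0..r}"
      by (rule dominated_convergence(1)[where f = "\<lambda>k. wavg (f k)", OF wavg_integrable[OF f] h]) (simp_all add: le[unfolded real_norm_def] wavg_lim)
    show "(\<lambda>k. pot (f k) r) \<longlonglongrightarrow> pot g r"
      unfolding pot_def
      by (rule dominated_convergence(2)[where f = "\<lambda>k. wavg (f k)", OF wavg_integrable[OF f] h]) (simp_all add: le[unfolded real_norm_def] wavg_lim)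
  qed
  show "(\<lambda>k. pot (f k) r) \<longlonglongrightarrow> pot g r" if "0 \<le> r" by (rule *)
  show "continuous_on {0..} (pot g)"
    unfolding continuous_on_def
  proof
    fix r :: real assume r: "r \<in> {0..}"
    have "(pot g \<longlongrightarrow> pot g r) (at r within {0..r+1})"
      using indefinite_integral_continuous_1[OF *(1)[of "r+1"]] r
      by (auto simp: continuous_on_def pot_def[abs_def])
    moreover have "at r within {0..r+1} = at r within {0..}"
      by (rule at_within_nhd[of _ "{..<r+1}"]) auto
    ultimately show "(pot g \<longlongrightarrow> pot g r) (at r within {0..})" by simp
  qed
qed

section \<open>The truncated system\<close>

text \<open>Integral form of the Cauchy problem with truncated powers. It incorporates the
  conditions at the pole and, being free of derivatives, passes to pointwise limits.\<close>

definition truncated_solution ::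
    "real \<Rightarrow> real \<Rightarrow> real \<Rightarrow> real \<Rightarrow> (real \<Rightarrow> real) \<Rightarrow> (real \<Rightarrow> real) \<Rightarrow> bool" where
  "truncated_solution p q \<xi> \<eta> u v \<longleftrightarrow>
     continuous_on {0..} u \<and> continuous_on {0..} v \<and>
     (\<forall>r\<ge>0. u r = \<xi> - pot (\<lambda>s. pos_powr q (v s)) r) \<and>
     (\<forall>r\<ge>0. v r = \<eta> - pot (\<lambda>s. pos_powr p (u s)) r)"

lemma truncated_solution_swap:
  "truncated_solution p q \<xi> \<eta> u v \<longleftrightarrow> truncated_solution q p \<eta> \<xi> v u"
  by (auto simp: truncated_solution_def)

text \<open>\<open>v' k\<close> is the image of \<open>v k\<close> under the fixed-point map with
  datum \<open>h k\<close>; since both sequences have the same limit, that limit is a fixed point.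
  This serves both successive iterates with a fixed datum and exact solutions with converging
  data.\<close>

lemma truncated_solution_limit:
  assumes pq: "0 < p" "0 < q"
    and v_cont: "\<And>k. continuous_on {0..} (v k)"
    and v_le: "\<And>k r. 0 \<le> r \<Longrightarrow> v k r \<le> c"
    and v'_eq: "\<And>k r. 0 \<le> r \<Longrightarrow>
        v' k r = h k - pot (\<lambda>s. pos_powr p (\<xi> - pot (\<lambda>t. pos_powr q (v k t)) s)) r"
    and lim: "\<And>r. 0 \<le> r \<Longrightarrow> (\<lambda>k. v k r) \<longlonglongrightarrow> v0 r"
             "\<And>r. 0 \<le> r \<Longrightarrow> (\<lambda>k. v' k r) \<longlonglongrightarrow> v0 r" "h \<longlonglongrightarrow> \<eta>"
  defines "u0 \<equiv> \<lambda>r. \<xi> - pot (\<lambda>t. pos_powr q (v0 t)) r"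
  shows "truncated_solution p q \<xi> \<eta> u0 v0"
    and "\<And>r. 0 \<le> r \<Longrightarrow> (\<lambda>k. \<xi> - pot (\<lambda>t. pos_powr q (v k t)) r) \<longlonglongrightarrow> u0 r"
proof -
  define u where "u k r = \<xi> - pot (\<lambda>t. pos_powr q (v k t)) r" for k r
  have f_cont: "continuous_on {0..} (\<lambda>t. pos_powr q (v k t))" for k
    by (intro continuous_on_pos_powr pq v_cont)
  note f_lim = pot_tendsto[where f = "\<lambda>k t. pos_powr q (v k t)" and g = "\<lambda>t. pos_powr q (v0 t)",
      OF f_cont pos_powr_nonneg pos_powr_mono[OF pq(2) v_le] tendsto_pos_powr[OF pq(2) lim(1)]]
  then have u0_cont: "continuous_on {0..} u0"
    unfolding u0_def by (intro continuous_intros)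
  show u_lim: "(\<lambda>k. \<xi> - pot (\<lambda>t. pos_powr q (v k t)) r) \<longlonglongrightarrow> u0 r" if "0 \<le> r" for r
    unfolding u0_def using that by (intro tendsto_intros f_lim(1))
  have u_cont: "continuous_on {0..} (u k)" for k
    unfolding u_def[abs_def] by (intro continuous_intros pot_continuous f_cont)
  have u_le: "u k r \<le> \<xi>" if "0 \<le> r" for k r
    unfolding u_def using pot_nonneg[OF f_cont, of r] by (simp add: pos_powr_nonneg)
  have g_cont: "continuous_on {0..} (\<lambda>t. pos_powr p (u k t))" for k
    by (intro continuous_on_pos_powr pq u_cont)
  have "(\<lambda>k. pot (\<lambda>t. pos_powr p (u k t)) r) \<longlonglongrightarrow> pot (\<lambda>t. pos_powr p (u0 t)) r" if "0 \<le> r" for r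
    using that pq u_le g_cont u_lim
    by (intro pot_tendsto(1)[where c = "pos_powr p \<xi>"])
       (auto simp: u_def[symmetric] intro!: pos_powr_nonneg pos_powr_mono tendsto_pos_powr)
  then have "(\<lambda>k. v' k r) \<longlonglongrightarrow> \<eta> - pot (\<lambda>t. pos_powr p (u0 t)) r" if "0 \<le> r" for r
    using that lim(3) by (auto simp: v'_eq u_def[symmetric] intro!: tendsto_intros)
  then have v0_eq: "v0 r = \<eta> - pot (\<lambda>t. pos_powr p (u0 t)) r" if "0 \<le> r" for r
    using LIMSEQ_unique lim(2) that by blast
  \<comment> \<open>So far \<open>v0\<close> is a mere pointwise limit; its continuity is read off
    from the equation it satisfies.\<close>
  have "continuous_on {0..} (\<lambda>r. \<eta> - pot (\<lambda>t. pos_powr p (u0 t)) r)"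
    by (intro continuous_intros pot_continuous continuous_on_pos_powr pq u0_cont)
  then have "continuous_on {0..} v0"
    by (rule continuous_on_eq) (auto simp: v0_eq)
  then show "truncated_solution p q \<xi> \<eta> u0 v0"
    unfolding truncated_solution_def using u0_cont v0_eq by (auto simp: u0_def)
qed

section \<open>Monotone iteration for the truncated system\<close>

primrec iter :: "real \<Rightarrow> real \<Rightarrow> real \<Rightarrow> real \<Rightarrow> nat \<Rightarrow> real \<Rightarrow> real" where
  "iter p q \<xi> \<eta> 0 = (\<lambda>_. \<eta>)"
| "iter p q \<xi> \<eta> (Suc k) =
     (\<lambda>r. \<eta> - pot (\<lambda>s. pos_powr p (\<xi> - pot (\<lambda>t. pos_powr q (iter p q \<xi> \<eta> k t)) s)) r)"

lemma iter_continuous: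
  assumes "0 < p" "0 < q"
  shows "continuous_on {0..} (iter p q \<xi> \<eta> k)"
  using assms by (induction k) (auto intro!: continuous_intros pot_continuous continuous_on_pos_powr)

text \<open>Each of the two nested potentials is subtracted, so two order-reversing maps compose to
  an order-preserving one.\<close>

lemma step_mono:
  assumes "0 < p" "0 < q" "continuous_on {0..} f" "continuous_on {0..} g" "\<eta> \<le> \<eta>'" "0 \<le> r"
    and "\<And>t. 0 \<le> t \<Longrightarrow> f t \<le> g t"
  shows "\<eta> - pot (\<lambda>s. pos_powr p (\<xi> - pot (\<lambda>t. pos_powr q (f t)) s)) r
      \<le> \<eta>' - pot (\<lambda>s. pos_powr p (\<xi> - pot (\<lambda>t. pos_powr q (g t)) s)) r"
  using assms
  by (intro diff_mono pot_mono)
     (auto intro!: diff_left_mono pot_mono pos_powr_mono continuous_intros pot_continuous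
       continuous_on_pos_powr)

lemma iter_mono:
  assumes "0 < p" "0 < q" "\<eta> \<le> \<eta>'" "0 \<le> r"
  shows "iter p q \<xi> \<eta> k r \<le> iter p q \<xi> \<eta>' k r"
  using assms(4)
proof (induction k arbitrary: r)
  case (Suc k)
  show ?case
    unfolding iter.simps using Suc assms by (intro step_mono iter_continuous) auto
qed (use assms in simp)

lemma iter_le:
  assumes "0 < p" "0 < q" "0 \<le> r"
  shows "iter p q \<xi> \<eta> k r \<le> \<eta>"
proof (cases k)
  case (Suc j)
  have "0 \<le> pot (\<lambda>s. pos_powr p (\<xi> - pot (\<lambda>t. pos_powr q (iter p q \<xi> \<eta> j t)) s)) r"
    using assms
    by (intro pot_nonneg pos_powr_nonneg)
       (auto intro!: continuous_intros pot_continuous continuous_on_pos_powr iter_continuous)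
  then show ?thesis by (simp add: Suc)
qed simp

text \<open>The constant start lies above its image, and monotonicity of the step propagates this to
  all iterates.\<close>

lemma iter_decseq:
  assumes "0 < p" "0 < q" "0 \<le> r"
  shows "decseq (\<lambda>k. iter p q \<xi> \<eta> k r)"
proof (rule decseq_SucI)
  show "iter p q \<xi> \<eta> (Suc k) r \<le> iter p q \<xi> \<eta> k r" for k
    using assms(3)
  proof (induction k arbitrary: r)
    case 0
    then show ?case using iter_le[OF assms(1,2) 0, of \<xi> \<eta> "Suc 0"] by simp
  next
    case (Suc k)
    show ?case
      by (subst (1 2) iter.simps(2), intro step_mono iter_continuous assms Suc) auto
  qed
qed

text \<open>The inner function never exceeds \<open>\<xi>\<close>, so the amount subtracted from
  \<open>\<eta>\<close> is bounded independently of \<open>k\<close>; hence the decreasing iterates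
  converge.\<close>

lemma iter_ge:
  assumes "0 < p" "0 < q" "0 \<le> r"
  shows "\<eta> - pos_powr p \<xi> * r\<^sup>2 \<le> iter p q \<xi> \<eta> k r"
proof (cases k)
  case 0
  then show ?thesis by (simp add: pos_powr_nonneg)
next
  case (Suc j)
  have "pot (\<lambda>s. pos_powr p (\<xi> - pot (\<lambda>t. pos_powr q (iter p q \<xi> \<eta> j t)) s)) r
      \<le> pos_powr p \<xi> * r\<^sup>2"
    using assms
    by (intro pot_le pos_powr_nonneg pos_powr_mono)
       (auto intro!: continuous_intros pot_continuous continuous_on_pos_powr iter_continuous
         pot_nonneg pos_powr_nonneg)
  then show ?thesis by (simp add: Suc)
qed

text \<open>By \<open>step_mono\<close>, every solution with the same data stays below all iterates,
  so their limit is the largest \<open>v\<close>. Uniqueness is established only while both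
  components are positive; this selection depends monotonically on \<open>\<eta>\<close>
  regardless.\<close>

definition vmax :: "real \<Rightarrow> real \<Rightarrow> real \<Rightarrow> real \<Rightarrow> real \<Rightarrow> real" where
  "vmax p q \<xi> \<eta> r = lim (\<lambda>k. iter p q \<xi> \<eta> k r)"

definition umin :: "real \<Rightarrow> real \<Rightarrow> real \<Rightarrow> real \<Rightarrow> real \<Rightarrow> real" where
  "umin p q \<xi> \<eta> r = \<xi> - pot (\<lambda>t. pos_powr q (vmax p q \<xi> \<eta> t)) r"

lemma iter_tendsto:
  assumes "0 < p" "0 < q" "0 \<le> r"
  shows "(\<lambda>k. iter p q \<xi> \<eta> k r) \<longlonglongrightarrow> vmax p q \<xi> \<eta> r"
proof -
  obtain L where "(\<lambda>k. iter p q \<xi> \<eta> k r) \<longlonglongrightarrow> L"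
    using decseq_convergent[OF iter_decseq[OF assms]] iter_ge[OF assms] by metis
  then show ?thesis by (simp add: vmax_def limI)
qed

lemma truncated_solution_vmax:
  assumes "0 < p" "0 < q"
  shows "truncated_solution p q \<xi> \<eta> (umin p q \<xi> \<eta>) (vmax p q \<xi> \<eta>)"
  unfolding umin_def[abs_def]
proof (rule truncated_solution_limit(1)[OF assms])
  show "(\<lambda>k. iter p q \<xi> \<eta> k r) \<longlonglongrightarrow> vmax p q \<xi> \<eta> r"
    and "(\<lambda>k. iter p q \<xi> \<eta> (Suc k) r) \<longlonglongrightarrow> vmax p q \<xi> \<eta> r" if "0 \<le> r" for r
    using iter_tendsto[OF assms that] LIMSEQ_Suc by blast+
  show "(\<lambda>_. \<eta>) \<longlonglongrightarrow> \<eta>" by simp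
qed (use iter_continuous[OF assms] iter_le[OF assms] in auto)

lemma vmax_mono:
  assumes "0 < p" "0 < q" "\<eta> \<le> \<eta>'" "0 \<le> r"
  shows "vmax p q \<xi> \<eta> r \<le> vmax p q \<xi> \<eta>' r"
  using iter_mono[OF assms] assms by (intro LIMSEQ_le[OF iter_tendsto iter_tendsto]) auto

lemma umin_antimono:
  assumes "0 < p" "0 < q" "\<eta> \<le> \<eta>'" "0 \<le> r"
  shows "umin p q \<xi> \<eta>' r \<le> umin p q \<xi> \<eta> r"
  unfolding umin_def using assms truncated_solution_vmax[OF assms(1,2)]
  by (intro diff_left_mono pot_mono continuous_on_pos_powr pos_powr_mono vmax_mono)
     (auto simp: truncated_solution_def)

lemma truncated_solution_le:
  assumes "0 < p" "truncated_solution p q \<xi> \<eta> u v" "0 \<le> r"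
  shows "v r \<le> \<eta>"
proof -
  have "0 \<le> pot (\<lambda>s. pos_powr p (u s)) r"
    using assms
    by (intro pot_nonneg) (auto intro!: continuous_on_pos_powr pos_powr_nonneg simp: truncated_solution_def)
  then show ?thesis using assms by (simp add: truncated_solution_def)
qed

text \<open>Monotone limits of the selected solutions exist and solve the system for the limiting
  datum, but they are not claimed to be the selected solution there. Hence the fresh
  \<open>u\<close> and \<open>v\<close>.\<close>

lemma truncated_solution_monotone_limit:
  assumes pq: "0 < p" "0 < q" and X: "monoseq X" "X \<longlonglongrightarrow> \<eta>"
  obtains u v where "truncated_solution p q \<xi> \<eta> u v"
    "\<And>r. 0 \<le> r \<Longrightarrow> (\<lambda>k. umin p q \<xi> (X k) r) \<longlonglongrightarrow> u r"
    "\<And>r. 0 \<le> r \<Longrightarrow> (\<lambda>k. vmax p q \<xi> (X k) r) \<longlonglongrightarrow> v r"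
proof -
  have "bounded (range X)" using X(2) convergent_def convergent_imp_bounded by blast
  then obtain a b where ab: "\<And>k. a \<le> X k" "\<And>k. X k \<le> b"
    by (metis bounded_real abs_le_D1 abs_le_D2 minus_le_iff rangeI)
  define v where "v r = lim (\<lambda>k. vmax p q \<xi> (X k) r)" for r
  have v_lim: "(\<lambda>k. vmax p q \<xi> (X k) r) \<longlonglongrightarrow> v r" if r: "0 \<le> r" for r
  proof -
    have "monoseq (\<lambda>k. vmax p q \<xi> (X k) r)"
      using X(1) vmax_mono[OF pq _ r] unfolding monoseq_def by blast
    moreover have "Bseq (\<lambda>k. vmax p q \<xi> (X k) r)"
    proof (rule BseqI')
      fix k
      show "norm (vmax p q \<xi> (X k) r) \<le> \<bar>vmax p q \<xi> a r\<bar> + \<bar>vmax p q \<xi> b r\<bar>"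
        using vmax_mono[OF pq ab(1) r, of \<xi> k] vmax_mono[OF pq ab(2) r, of \<xi> k] by simp
    qed
    ultimately show ?thesis
      unfolding v_def by (simp add: Bseq_monoseq_convergent convergent_LIMSEQ_iff[symmetric])
  qed
  note sol = truncated_solution_vmax[OF pq, of \<xi>]
  have c: "continuous_on {0..} (vmax p q \<xi> (X k))" for k
    using sol[of "X k"] by (simp add: truncated_solution_def)
  have le: "vmax p q \<xi> (X k) r \<le> b" if "0 \<le> r" for k r
    using truncated_solution_le[OF pq(1) sol that] ab(2) order_trans by blast
  have eq: "vmax p q \<xi> (X k) r
      = X k - pot (\<lambda>s. pos_powr p (\<xi> - pot (\<lambda>t. pos_powr q (vmax p q \<xi> (X k) t)) s)) r"
    if "0 \<le> r" for k r
    using sol[of "X k"] that by (simp add: truncated_solution_def umin_def)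
  \<comment> \<open>Exact solutions are fixed points, so one sequence takes the roles of both
    \<open>v\<close> and \<open>v'\<close>, while \<open>X\<close> takes that of
    \<open>h\<close>.\<close>
  show thesis
    by (rule that, rule truncated_solution_limit(1)[OF pq c le eq v_lim v_lim X(2)])
       (auto simp: umin_def intro!: v_lim truncated_solution_limit(2)[OF pq c le eq v_lim v_lim X(2)])
qed

text \<open>Gronwall's argument for the sum of the two distances; the bound \<open>d\<close> keeps
  all components where the powers are Lipschitz.\<close>

lemma truncated_solution_unique:
  assumes pq: "0 < p" "0 < q"
    and sol: "truncated_solution p q \<xi> \<eta> u1 v1" "truncated_solution p q \<xi> \<eta> u2 v2"
    and d: "0 < d" "0 \<le> R"
      "\<And>r. 0 \<le> r \<Longrightarrow> r \<le> R \<Longrightarrow> d \<le> u1 r \<and> d \<le> v1 r \<and> d \<le> u2 r \<and> d \<le> v2 r"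
  shows "u1 R = u2 R \<and> v1 R = v2 R"
proof -
  \<comment> \<open>Stated for arbitrary data because it is used a second time with components and
    exponents exchanged.\<close>
  have diff_le: "\<bar>v1 r - v2 r\<bar> \<le> L * (R * integral {0..r} (\<lambda>t. \<bar>u1 t - u2 t\<bar>))"
    if sol: "truncated_solution p q \<xi> \<eta> u1 v1" "truncated_solution p q \<xi> \<eta> u2 v2"
      and r: "0 \<le> r" "r \<le> R" and p: "0 < p" and L: "0 \<le> L"
      "\<And>s. 0 \<le> s \<Longrightarrow> s \<le> R \<Longrightarrow> \<bar>pos_powr p (u1 s) - pos_powr p (u2 s)\<bar> \<le> L * \<bar>u1 s - u2 s\<bar>"
    for p q \<xi> \<eta> u1 v1 u2 v2 r L
  proof -
    let ?D = "\<lambda>t. \<bar>u1 t - u2 t\<bar>"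
    have u: "continuous_on {0..} u1" "continuous_on {0..} u2"
      using sol by (auto simp: truncated_solution_def)
    have pu: "continuous_on {0..} (\<lambda>t. pos_powr p (u1 t))" "continuous_on {0..} (\<lambda>t. pos_powr p (u2 t))"
      by (intro continuous_on_pos_powr p u)+
    have D: "continuous_on {0..} ?D" using u by (intro continuous_intros)
    then have LD: "continuous_on {0..} (\<lambda>t. L * ?D t)" by (rule continuous_on_mult_left)
    have "pot (\<lambda>t. pos_powr p (u1 t)) r \<le> pot (\<lambda>t. pos_powr p (u2 t) + L * ?D t) r"
      using r L by (intro pot_mono pu continuous_intros LD) (force simp: abs_le_iff)
    moreover have "pot (\<lambda>t. pos_powr p (u2 t)) r \<le> pot (\<lambda>t. pos_powr p (u1 t) + L * ?D t) r"
      using r L by (intro pot_mono pu continuous_intros LD) (force simp: abs_le_iff)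
    ultimately have "\<bar>v1 r - v2 r\<bar> \<le> L * pot ?D r"
      using sol r by (simp add: truncated_solution_def pot_add pu LD pot_cmult)
    also have "\<dots> \<le> L * (r * integral {0..r} ?D)"
      using L r by (intro mult_left_mono pot_le_integral D) auto
    also have "\<dots> \<le> L * (R * integral {0..r} ?D)"
      using L r by (intro mult_left_mono mult_right_mono integral_nonneg integrable_halfline[OF D]) auto
    finally show ?thesis .
  qed
  have swap: "truncated_solution q p \<eta> \<xi> v1 u1" "truncated_solution q p \<eta> \<xi> v2 u2"
    using sol truncated_solution_swap by auto
  define M where "M = max \<xi> \<eta>"
  have le: "u1 r \<le> M" "v1 r \<le> M" "u2 r \<le> M" "v2 r \<le> M" if "0 \<le> r" for r
    using that truncated_solution_le[OF pq(1) sol(1)] truncated_solution_le[OF pq(1) sol(2)]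
      truncated_solution_le[OF pq(2) swap(1)] truncated_solution_le[OF pq(2) swap(2)]
    by (fastforce simp: M_def max_def)+
  obtain Lp where Lp: "0 \<le> Lp"
    "\<And>x y. d \<le> x \<Longrightarrow> x \<le> M \<Longrightarrow> d \<le> y \<Longrightarrow> y \<le> M \<Longrightarrow> \<bar>pos_powr p x - pos_powr p y\<bar> \<le> Lp * \<bar>x - y\<bar>"
    using pos_powr_Lipschitz[OF d(1) pq(1), of M] by metis
  obtain Lq where Lq: "0 \<le> Lq"
    "\<And>x y. d \<le> x \<Longrightarrow> x \<le> M \<Longrightarrow> d \<le> y \<Longrightarrow> y \<le> M \<Longrightarrow> \<bar>pos_powr q x - pos_powr q y\<bar> \<le> Lq * \<bar>x - y\<bar>"
    using pos_powr_Lipschitz[OF d(1) pq(2), of M] by metis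
  \<comment> \<open>Adding the estimates for the two components adds their Lipschitz constants; the
    factor \<open>R\<close> comes from \<open>diff_le\<close>.\<close>
  define L where "L = (Lp + Lq) * R"
  define D where "D t = \<bar>u1 t - u2 t\<bar> + \<bar>v1 t - v2 t\<bar>" for t
  define I where "I r = integral {0..r} D" for r
  have cont: "continuous_on {0..} (\<lambda>t. \<bar>u1 t - u2 t\<bar>)" "continuous_on {0..} (\<lambda>t. \<bar>v1 t - v2 t\<bar>)"
    using sol by (auto simp: truncated_solution_def intro!: continuous_intros)
  then have D: "continuous_on {0..} D" unfolding D_def[abs_def] by (rule continuous_on_add)
  have D_le: "D r \<le> L * I r" if r: "0 \<le> r" "r \<le> R" for r
  proof -
    have I_eq: "I r = integral {0..r} (\<lambda>t. \<bar>u1 t - u2 t\<bar>) + integral {0..r} (\<lambda>t. \<bar>v1 t - v2 t\<bar>)"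
      unfolding I_def D_def[abs_def] by (intro integral_add integrable_halfline cont) auto
    have nonneg: "0 \<le> integral {0..r} (\<lambda>t. \<bar>u1 t - u2 t\<bar>)" "0 \<le> integral {0..r} (\<lambda>t. \<bar>v1 t - v2 t\<bar>)"
      by (intro integral_nonneg integrable_halfline cont; simp)+
    have "\<bar>v1 r - v2 r\<bar> \<le> Lp * (R * integral {0..r} (\<lambda>t. \<bar>u1 t - u2 t\<bar>))"
      using d le Lp by (intro diff_le[OF sol r pq(1)]) auto
    moreover have "\<bar>u1 r - u2 r\<bar> \<le> Lq * (R * integral {0..r} (\<lambda>t. \<bar>v1 t - v2 t\<bar>))"
      using d le Lq by (intro diff_le[OF swap r pq(2)]) auto
    moreover have "0 \<le> Lq * (R * integral {0..r} (\<lambda>t. \<bar>u1 t - u2 t\<bar>))"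
      "0 \<le> Lp * (R * integral {0..r} (\<lambda>t. \<bar>v1 t - v2 t\<bar>))"
      using nonneg Lp(1) Lq(1) d(2) by simp_all
    ultimately show ?thesis by (simp add: D_def L_def I_eq algebra_simps)
  qed
  have I_deriv: "(I has_real_derivative D r) (at r within {0..})" if "0 \<le> r" for r
    unfolding I_def[abs_def] using integral_halfline_has_derivative[OF D that] .
  have I_nonneg: "0 \<le> I r" for r
    unfolding I_def by (intro integral_nonneg integrable_halfline[OF D]) (auto simp: D_def)
  \<comment> \<open>Since \<open>I' = D \<le> L * I\<close>, the function
    \<open>exp (- L * r) * I r\<close> is nonincreasing, and it starts at \<open>0\<close>.\<close>
  have "exp (- L * 0) * I 0 \<ge> exp (- L * R) * I R"
  proof (rule DERIV_nonpos_imp_decreasing_open[OF d(2)])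
    show "continuous_on {0..R} (\<lambda>r. exp (- L * r) * I r)"
      by (intro continuous_intros
          continuous_on_subset[OF has_derivative_imp_continuous_on_halfline[OF I_deriv]]) auto
    fix r assume r: "0 < r" "r < R"
    have "((\<lambda>r. exp (- L * r) * I r) has_real_derivative exp (- L * r) * (D r - L * I r)) (at r)"
      using I_deriv[of r] r
      by (auto simp: at_within_halfline intro!: derivative_eq_intros simp: algebra_simps)
    then show "\<exists>y. ((\<lambda>r. exp (- L * r) * I r) has_real_derivative y) (at r) \<and> y \<le> 0"
      using D_le[of r] r by (intro exI conjI) (auto simp: mult_nonneg_nonpos)
  qed
  then have "I R = 0"
    using I_nonneg[of R] by (simp add: I_def mult_le_0_iff)
  then have "D R \<le> 0" using D_le[of R] d(2) by simp
  then show ?thesis by (auto simp: D_def)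
qed

section \<open>Shooting\<close>

lemma truncated_solution_has_derivative:
  assumes "0 < q" "truncated_solution p q \<xi> \<eta> u v" "0 \<le> r"
  shows "(u has_real_derivative - wavg (\<lambda>s. pos_powr q (v s)) r) (at r within {0..})"
proof -
  have f: "continuous_on {0..} (\<lambda>s. pos_powr q (v s))"
    using assms by (intro continuous_on_pos_powr) (auto simp: truncated_solution_def)
  have "((\<lambda>r. \<xi> - pot (\<lambda>s. pos_powr q (v s)) r) has_real_derivative
      - wavg (\<lambda>s. pos_powr q (v s)) r) (at r within {0..})"
    using assms(3) by (auto intro!: derivative_eq_intros pot_has_derivative f)
  then show ?thesis
    by (rule has_field_derivative_transform_within[OF _ zero_less_one])
       (use assms in \<open>auto simp: truncated_solution_def\<close>)
qed

lemma truncated_solution_0: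
  assumes "truncated_solution p q \<xi> \<eta> u v"
  shows "u 0 = \<xi>" "v 0 = \<eta>"
  using assms by (simp_all add: truncated_solution_def pot_0)

lemma truncated_solution_wavg_pos:
  assumes "0 < q" "truncated_solution p q \<xi> \<eta> u v" "0 < \<eta>" "0 < r"
  shows "0 < wavg (\<lambda>s. pos_powr q (v s)) r"
  using assms truncated_solution_0(2)[OF assms(2)]
  by (intro wavg_pos continuous_on_pos_powr pos_powr_nonneg)
     (auto simp: truncated_solution_def pos_powr_def)

text \<open>\<open>- u'\<close> averages the truncated powers of \<open>v\<close>, which are
  positive near the pole; so \<open>u\<close> keeps decreasing strictly even where \<open>v\<close>
  is already negative.\<close>

lemma truncated_solution_decreasing:
  assumes "0 < q" "truncated_solution p q \<xi> \<eta> u v" "0 < \<eta>" "0 \<le> r" "r < s"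
  shows "u s < u r"
proof (rule DERIV_neg_imp_decreasing_open[OF assms(5)])
  fix x assume "r < x" "x < s"
  then have x: "0 < x" using assms by simp
  then have "(u has_real_derivative - wavg (\<lambda>s. pos_powr q (v s)) x) (at x)"
    using truncated_solution_has_derivative[OF assms(1,2), of x] by (simp add: at_within_halfline)
  then show "\<exists>y. (u has_real_derivative y) (at x) \<and> y < 0"
    using truncated_solution_wavg_pos[OF assms(1-3) x] by (intro exI conjI) auto
next
  show "continuous_on {r..s} u"
    using assms by (auto simp: truncated_solution_def intro: continuous_on_subset)
qed

text \<open>For strictly decreasing components this says that \<open>u\<close> vanishes strictly
  before \<open>v\<close> does, if \<open>v\<close> vanishes at all. Strict inequalities at a single
  radius make it an open condition: if a pointwise limit has it, so do late members of the
  sequence.\<close>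

definition dies_before :: "(real \<Rightarrow> real) \<Rightarrow> (real \<Rightarrow> real) \<Rightarrow> bool" where
  "dies_before u v \<longleftrightarrow> (\<exists>r\<ge>0. u r < 0 \<and> 0 < v r)"

text \<open>Of the two witnessing radii, at the later one the component that was negative at the
  earlier one would have to be positive again.\<close>

lemma not_both_die_first:
  assumes "0 < p" "0 < q" "truncated_solution p q \<xi> \<eta> u v" "0 < \<xi>" "0 < \<eta>"
    and "dies_before u v" "dies_before v u"
  shows False
proof -
  obtain r s where "0 \<le> r" "u r < 0" "0 < v r" "0 \<le> s" "v s < 0" "0 < u s"
    using assms(6,7) by (auto simp: dies_before_def)
  moreover have "truncated_solution q p \<eta> \<xi> v u"
    using assms(3) truncated_solution_swap by blast
  ultimately show False
    using truncated_solution_decreasing[OF assms(2,3,5)]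
      truncated_solution_decreasing[OF assms(1) \<open>truncated_solution q p \<eta> \<xi> v u\<close> assms(4)]
    by (metis linorder_neqE_linordered_idom order.strict_trans order.asym)
qed

lemma first_zero:
  assumes "0 < q" "truncated_solution p q \<xi> \<eta> u v" "0 < \<eta>" "0 < \<xi>" "0 \<le> r" "u r \<le> 0"
  obtains R where "0 < R" "R \<le> r" "u R = 0" "\<And>s. 0 \<le> s \<Longrightarrow> s < R \<Longrightarrow> 0 < u s"
proof -
  have "continuous_on {0..r} u"
    using assms by (auto simp: truncated_solution_def intro: continuous_on_subset)
  moreover note u0 = truncated_solution_0(1)[OF assms(2)]
  ultimately obtain R where R: "0 \<le> R" "R \<le> r" "u R = 0"
    using IVT2'[of u r 0 0] assms by auto
  moreover have "R \<noteq> 0" using R u0 assms by auto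
  moreover have "0 < u s" if "0 \<le> s" "s < R" for s
    using truncated_solution_decreasing[OF assms(1-3) that] R by simp
  ultimately show thesis using that[of R] by simp
qed

text \<open>The sign of \<open>v\<close> at the first zero \<open>R\<close> of \<open>u\<close>
  decides: if positive, \<open>u\<close> is negative just after \<open>R\<close> while
  \<open>v\<close> is still positive; if negative, \<open>v\<close> is negative just before
  \<open>R\<close> while \<open>u\<close> is still positive; otherwise \<open>R\<close> is a common
  zero.\<close>

lemma truncated_solution_alternatives:
  assumes "0 < p" "0 < q" "truncated_solution p q \<xi> \<eta> u v" "0 < \<xi>" "0 < \<eta>"
    and "0 \<le> r" "u r \<le> 0"
  shows "dies_before u v \<or> dies_before v u \<or>
    (\<exists>R>0. u R = 0 \<and> v R = 0 \<and> (\<forall>s. 0 \<le> s \<longrightarrow> s < R \<longrightarrow> 0 < u s \<and> 0 < v s))"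
proof -
  obtain R where R: "0 < R" "u R = 0" "\<And>s. 0 \<le> s \<Longrightarrow> s < R \<Longrightarrow> 0 < u s"
    using first_zero[OF assms(2,3,5,4,6,7)] by blast
  have swap: "truncated_solution q p \<eta> \<xi> v u"
    using assms(3) truncated_solution_swap by blast
  have v: "continuous_on {0..} v" using assms by (simp add: truncated_solution_def)
  consider "0 < v R" | "v R < 0" | "v R = 0" by linarith
  then show ?thesis
  proof cases
    case 1
    then obtain d where "0 < d" "\<And>s. 0 \<le> s \<Longrightarrow> \<bar>s - R\<bar> < d \<Longrightarrow> - v s < 0"
      using continuous_halfline_near[of "\<lambda>s. - v s" R 0] v R by (auto intro: continuous_intros)
    then have "0 < v (R + d/2)" using R by force
    moreover have "u (R + d/2) < u R"
      using \<open>0 < d\<close> R by (intro truncated_solution_decreasing[OF assms(2,3,5)]) auto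
    ultimately have "dies_before u v"
      unfolding dies_before_def using R \<open>0 < d\<close> by (intro exI[of _ "R + d/2"]) auto
    then show ?thesis ..
  next
    case 2
    then obtain d where d: "0 < d" "\<And>s. 0 \<le> s \<Longrightarrow> \<bar>s - R\<bar> < d \<Longrightarrow> v s < 0"
      using continuous_halfline_near[of v R 0] v R by auto
    \<comment> \<open>The minimum with \<open>R\<close> keeps \<open>s\<close> nonnegative.\<close>
    define s where "s = R - min R (d/2)"
    have "0 \<le> s" "s < R" "\<bar>s - R\<bar> < d" using d R by (auto simp: s_def)
    then have "dies_before v u" unfolding dies_before_def using d R by blast
    then show ?thesis by simp
  next
    case 3
    have "0 < v s" if "0 \<le> s" "s < R" for s
      using truncated_solution_decreasing[OF assms(1) swap assms(4) that] 3 by simp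
    then show ?thesis using R 3 by blast
  qed
qed

text \<open>Below \<open>R1\<close> all components are positive, so the two solutions coincide
  there; but \<open>v1\<close> tends to \<open>0\<close> at \<open>R1\<close> while
  \<open>v2\<close> stays above \<open>v2 R2 > 0\<close>. Uniqueness is applied slightly before
  \<open>R1\<close>, because \<open>v1\<close> vanishes at \<open>R1\<close> itself.\<close>

lemma opposite_fates_impossible_aux:
  assumes pq: "0 < p" "0 < q" and "0 < \<xi>" "0 < \<eta>"
    and sol: "truncated_solution p q \<xi> \<eta> u1 v1" "truncated_solution p q \<xi> \<eta> u2 v2"
    and R1: "0 < R1" "v1 R1 = 0" "0 < u1 R1"
    and R2: "0 < R2" "u2 R2 = 0" "0 < v2 R2" and "R1 \<le> R2"
  shows False
proof -
  have swap: "truncated_solution q p \<eta> \<xi> v1 u1" "truncated_solution q p \<eta> \<xi> v2 u2"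
    using sol truncated_solution_swap by auto
  note u_dec = truncated_solution_decreasing[OF pq(2) _ \<open>0 < \<eta>\<close>]
  note v_dec = truncated_solution_decreasing[OF pq(1) _ \<open>0 < \<xi>\<close>]
  have "continuous_on {0..} v1" using sol by (simp add: truncated_solution_def)
  then obtain d where d: "0 < d" "\<And>s. 0 \<le> s \<Longrightarrow> \<bar>s - R1\<bar> < d \<Longrightarrow> v1 s < v2 R2"
    using continuous_halfline_near[of v1 R1 "v2 R2"] R1 R2 by auto
  define s where "s = R1 - min R1 (d/2)"
  have s: "0 \<le> s" "s < R1" "\<bar>s - R1\<bar> < d" using d R1 by (auto simp: s_def)
  \<comment> \<open>Since the components decrease, these four values bound them from below on
    \<open>{0..s}\<close>.\<close>
  define e where "e = Min {u1 R1, v1 s, u2 s, v2 R2}"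
  have "0 < e"
    using R1 R2 s \<open>R1 \<le> R2\<close> v_dec[OF swap(1) s(1,2)] u_dec[OF sol(2) s(1), of R2]
    by (auto simp: e_def)
  have "e \<le> u1 r \<and> e \<le> v1 r \<and> e \<le> u2 r \<and> e \<le> v2 r" if r: "0 \<le> r" "r \<le> s" for r
  proof -
    have "u1 R1 \<le> u1 r" "v2 R2 \<le> v2 r" "v1 s \<le> v1 r" "u2 s \<le> u2 r"
      using u_dec[OF sol(1) r(1), of R1] v_dec[OF swap(2) r(1), of R2]
        v_dec[OF swap(1) r(1), of s] u_dec[OF sol(2) r(1), of s] r s \<open>R1 \<le> R2\<close>
      by (cases "r = s"; simp)+
    then show ?thesis by (auto simp: e_def min_le_iff_disj)
  qed
  then have "v1 s = v2 s"
    using truncated_solution_unique[OF pq sol \<open>0 < e\<close> s(1)] by blast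
  moreover have "v1 s < v2 R2" using d s by blast
  moreover have "v2 R2 < v2 s" using v_dec[OF swap(2) s(1)] s \<open>R1 \<le> R2\<close> by simp
  ultimately show False by simp
qed

lemma dies_before_zero:
  assumes "0 < p" "0 < q" "0 < \<xi>" "0 < \<eta>" "truncated_solution p q \<xi> \<eta> u v" "dies_before u v"
  obtains R where "0 < R" "u R = 0" "0 < v R"
proof -
  obtain r where r: "0 \<le> r" "u r < 0" "0 < v r" using assms by (auto simp: dies_before_def)
  then obtain R where R: "0 < R" "R \<le> r" "u R = 0"
    using first_zero[OF assms(2,5,4,3)] by (metis less_imp_le)
  have "truncated_solution q p \<eta> \<xi> v u" using assms(5) truncated_solution_swap by blast
  from truncated_solution_decreasing[OF assms(1) this assms(3), of R r]
  have "v r < v R" using R r by (cases "R = r") auto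
  then show thesis using that R r by auto
qed

lemma opposite_fates_impossible:
  assumes pq: "0 < p" "0 < q" and pos: "0 < \<xi>" "0 < \<eta>"
    and sol: "truncated_solution p q \<xi> \<eta> u1 v1" "truncated_solution p q \<xi> \<eta> u2 v2"
    and dies: "dies_before v1 u1" "dies_before u2 v2"
  shows False
proof -
  have swap: "truncated_solution q p \<eta> \<xi> v1 u1" "truncated_solution q p \<eta> \<xi> v2 u2"
    using sol truncated_solution_swap by auto
  obtain R1 where R1: "0 < R1" "v1 R1 = 0" "0 < u1 R1"
    using dies_before_zero[OF pq(2,1) pos(2,1) swap(1) dies(1)] .
  obtain R2 where R2: "0 < R2" "u2 R2 = 0" "0 < v2 R2"
    using dies_before_zero[OF pq pos sol(2) dies(2)] .
  show False
  proof (cases "R1 \<le> R2")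
    case True
    then show ?thesis using opposite_fates_impossible_aux[OF pq pos sol R1 R2] by simp
  next
    case False
    \<comment> \<open>Exchanging both the components and the two solutions exchanges
      \<open>R1\<close> and \<open>R2\<close>.\<close>
    then show ?thesis
      using opposite_fates_impossible_aux[OF pq(2,1) pos(2,1) swap(2,1) R2 R1] by simp
  qed
qed

section \<open>Fates for extreme values of \<eta>, and the critical value\<close>

lemma dies_before_if_large:
  assumes pq: "0 < p" "0 < q" and "0 < \<xi>" and sol: "truncated_solution p q \<xi> \<eta> u v"
    and large: "2 * pos_powr p \<xi> \<le> \<eta>" "\<xi> < pos_powr q (\<eta> / 2) * pot (\<lambda>_. 1) 1"
  shows "dies_before u v"
proof -
  have cont: "continuous_on {0..} u" "continuous_on {0..} v"
    using sol by (auto simp: truncated_solution_def)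
  have swap: "truncated_solution q p \<eta> \<xi> v u"
    using sol truncated_solution_swap by blast
  have "0 < pos_powr p \<xi>" using \<open>0 < \<xi>\<close> by (simp add: pos_powr_def)
  \<comment> \<open>As \<open>u \<le> \<xi>\<close>, the component \<open>v\<close> loses at most
    \<open>pos_powr p \<xi> \<le> \<eta> / 2\<close> on \<open>{0..1}\<close>. A \<open>v\<close>
    this large then makes \<open>u\<close> drop by more than \<open>\<xi>\<close> up to radius
    \<open>1\<close>.\<close>
  have v_ge: "\<eta> / 2 \<le> v r" if r: "0 \<le> r" "r \<le> 1" for r
  proof -
    have "pot (\<lambda>s. pos_powr p (u s)) r \<le> pos_powr p \<xi> * r\<^sup>2"
      using r cont pq truncated_solution_le[OF pq(2) swap]
      by (intro pot_le pos_powr_nonneg pos_powr_mono continuous_on_pos_powr) auto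
    also have "\<dots> \<le> pos_powr p \<xi> * 1"
      using r by (intro mult_left_mono pos_powr_nonneg) (auto simp: power_le_one)
    finally show ?thesis using sol r large by (simp add: truncated_solution_def)
  qed
  have "pos_powr q (\<eta> / 2) * pot (\<lambda>_. 1) 1 \<le> pot (\<lambda>s. pos_powr q (v s)) 1"
    unfolding pot_cmult[symmetric] using pq cont v_ge
    by (intro pot_mono continuous_on_pos_powr) (auto intro: pos_powr_mono)
  then have "u 1 < 0" using sol large by (simp add: truncated_solution_def)
  moreover have "0 < v 1" using v_ge[of 1] large \<open>0 < pos_powr p \<xi>\<close> by simp
  ultimately show ?thesis unfolding dies_before_def by (intro exI[of _ 1]) simp
qed

text \<open>After exchanging the components, a small \<open>\<eta>\<close> with \<open>\<xi>\<close>
  fixed is the case of a relatively large second datum.\<close>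

lemma dies_before_if_small:
  assumes pq: "0 < p" "0 < q" and "0 < \<xi>" and sol: "truncated_solution p q \<xi> \<eta> u v"
    and small: "2 * pos_powr q \<eta> \<le> \<xi>" "\<eta> < pos_powr p (\<xi> / 2) * pot (\<lambda>_. 1) 1" and "0 < \<eta>"
  shows "dies_before v u"
  using dies_before_if_large[OF pq(2,1) \<open>0 < \<eta>\<close> _ small] sol truncated_solution_swap by blast

lemma pot_one_pos: "0 < pot (\<lambda>_. 1) 1"
proof -
  have "pot (\<lambda>_. 1) 0 < pot (\<lambda>_. 1) 1"
  proof (rule DERIV_pos_imp_increasing_open[where f = "pot (\<lambda>_. 1)"])
    fix x :: real assume x: "0 < x" "x < 1"
    have "(pot (\<lambda>_. 1) has_real_derivative wavg (\<lambda>_. 1) x) (at x)"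
      using pot_has_derivative[of "\<lambda>_. 1" x] x by (simp add: at_within_halfline)
    then show "\<exists>y. (pot (\<lambda>_. 1) has_real_derivative y) (at x) \<and> 0 < y"
      using wavg_pos[of "\<lambda>_. 1" x] x by (intro exI conjI) auto
  next
    show "continuous_on {0..1} (pot (\<lambda>_. 1))"
      by (rule continuous_on_subset[OF pot_continuous]) auto
  qed simp
  then show ?thesis by (simp add: pot_0)
qed

text \<open>Exclusion of a common zero is taken as a hypothesis, which separates the shooting
  argument from the geometry and the condition on the exponents.\<close>

theorem positive_solution_exists:
  assumes pq: "0 < p" "0 < q" and \<xi>: "0 < \<xi>"
    and no_common_zero: "\<And>\<eta> u v R. \<lbrakk>0 < \<eta>; truncated_solution p q \<xi> \<eta> u v; 0 < R; u R = 0; v R = 0;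
        \<And>s. 0 \<le> s \<Longrightarrow> s < R \<Longrightarrow> 0 < u s \<and> 0 < v s\<rbrakk> \<Longrightarrow> False"
  shows "\<exists>\<eta>>0. \<exists>u v. truncated_solution p q \<xi> \<eta> u v \<and> (\<forall>r\<ge>0. 0 < u r \<and> 0 < v r)"
proof (rule ccontr)
  assume none: "\<not> ?thesis"
  \<comment> \<open>The dichotomy is stated for all solutions and not only the selected ones, since
    it is applied to limits of selected solutions.\<close>
  have fate: "dies_before u v \<or> dies_before v u"
    if "0 < \<eta>" and sol: "truncated_solution p q \<xi> \<eta> u v" for \<eta> u v
  proof -
    have swap: "truncated_solution q p \<eta> \<xi> v u"
      using sol truncated_solution_swap by blast
    have "\<not> (\<forall>r\<ge>0. 0 < u r \<and> 0 < v r)" using none that by blast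
    then obtain r where "0 \<le> r" "u r \<le> 0 \<or> v r \<le> 0" by force
    then have "dies_before u v \<or> dies_before v u \<or>
        (\<exists>R>0. u R = 0 \<and> v R = 0 \<and> (\<forall>s. 0 \<le> s \<longrightarrow> s < R \<longrightarrow> 0 < u s \<and> 0 < v s))"
      using truncated_solution_alternatives[OF pq sol \<xi> \<open>0 < \<eta>\<close>, of r]
        truncated_solution_alternatives[OF pq(2,1) swap \<open>0 < \<eta>\<close> \<xi>, of r]
      by blast
    then show ?thesis using no_common_zero[OF that] by blast
  qed
  let ?u = "umin p q \<xi>" and ?v = "vmax p q \<xi>"
  note sol = truncated_solution_vmax[OF pq, of \<xi>]
  define A where "A = {\<eta>. 0 < \<eta> \<and> dies_before (?v \<eta>) (?u \<eta>)}"
  \<comment> \<open>Lowering \<open>\<eta>\<close> lowers \<open>v\<close> and raises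
    \<open>u\<close>, so \<open>v\<close> still vanishes first.\<close>
  have A_down: "\<eta> \<in> A" if "\<eta>' \<in> A" "0 < \<eta>" "\<eta> \<le> \<eta>'" for \<eta> \<eta>'
  proof -
    from that(1) obtain r where "0 \<le> r" "?v \<eta>' r < 0" "0 < ?u \<eta>' r"
      unfolding A_def dies_before_def by blast
    then have "?v \<eta> r < 0" "0 < ?u \<eta> r"
      using vmax_mono[OF pq \<open>\<eta> \<le> \<eta>'\<close> \<open>0 \<le> r\<close>, of \<xi>] umin_antimono[OF pq \<open>\<eta> \<le> \<eta>'\<close> \<open>0 \<le> r\<close>, of \<xi>]
      by simp_all
    then show ?thesis using \<open>0 \<le> r\<close> \<open>0 < \<eta>\<close> by (auto simp: A_def dies_before_def)
  qed
  let ?c = "pot (\<lambda>_. 1) 1"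
  have "A \<noteq> {}"
  proof -
    \<comment> \<open>The first entry gives \<open>2 * pos_powr q \<eta> \<le> \<xi>\<close>; the
      second is half the bound required, which yields the strict inequality.\<close>
    define \<eta> where "\<eta> = min ((\<xi> / 2) powr (1 / q)) (pos_powr p (\<xi> / 2) * ?c / 2)"
    have "0 < pos_powr p (\<xi> / 2) * ?c" using pot_one_pos \<xi> by (simp add: pos_powr_def)
    moreover from this have \<eta>: "0 < \<eta>" using \<xi> by (simp add: \<eta>_def)
    moreover have "\<eta> powr q \<le> ((\<xi> / 2) powr (1 / q)) powr q"
      using pq \<eta> by (intro powr_mono2) (auto simp: \<eta>_def)
    then have "2 * pos_powr q \<eta> \<le> \<xi>"
      using \<eta> \<xi> pq by (simp add: pos_powr_def powr_powr)
    moreover have "\<eta> \<le> pos_powr p (\<xi> / 2) * ?c / 2" unfolding \<eta>_def by simp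
    ultimately have "dies_before (?v \<eta>) (?u \<eta>)"
      by (intro dies_before_if_small[OF pq \<xi> sol]) simp_all
    then show ?thesis using \<eta> by (auto simp: A_def)
  qed
  obtain b where b: "0 < b" "b \<notin> A"
  proof -
    \<comment> \<open>The first entry gives \<open>2 * pos_powr p \<xi> \<le> b\<close>; the second
      gives \<open>2 * \<xi> \<le> pos_powr q (b / 2) * ?c\<close>, with a factor \<open>2\<close>
      to spare for strictness.\<close>
    define b where "b = max (2 * pos_powr p \<xi>) (2 * ((2 * \<xi> / ?c) powr (1 / q)))"
    have pos: "0 < 2 * \<xi> / ?c" using pot_one_pos \<xi> by simp
    have "0 < b" using \<xi> by (simp add: b_def less_max_iff_disj pos_powr_def)
    have "((2 * \<xi> / ?c) powr (1 / q)) powr q \<le> (b / 2) powr q"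
      using pq by (intro powr_mono2) (auto simp: b_def)
    then have "2 * \<xi> / ?c \<le> (b / 2) powr q"
      using pq pos by (simp add: powr_powr powr_one_gt_zero_iff abs_of_pos del: abs_divide zero_less_divide_iff)
    then have "2 * \<xi> \<le> pos_powr q (b / 2) * ?c"
      using pot_one_pos \<open>0 < b\<close> by (simp add: pos_powr_def field_simps)
    then have "\<xi> < pos_powr q (b / 2) * ?c" using \<xi> by simp
    then have "dies_before (?u b) (?v b)"
      by (intro dies_before_if_large[OF pq \<xi> sol]) (auto simp: b_def)
    then have "b \<notin> A" using not_both_die_first[OF pq sol \<xi> \<open>0 < b\<close>] by (auto simp: A_def)
    then show thesis using that \<open>0 < b\<close> by blast
  qed
  have "\<eta> \<le> b" if "\<eta> \<in> A" for \<eta> using A_down[OF that b(1)] b(2) by force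
  then have bdd: "bdd_above A" by (rule bdd_aboveI)
  define \<eta> where "\<eta> = Sup A"
  have "0 < \<eta>"
  proof -
    obtain a where "a \<in> A" using \<open>A \<noteq> {}\<close> by blast
    then show ?thesis using cSup_upper[OF _ bdd, of a] by (auto simp: A_def \<eta>_def)
  qed
  have below: "x \<in> A" if "0 < x" "x < \<eta>" for x
    using less_cSupD[OF \<open>A \<noteq> {}\<close>, of x] that A_down by (force simp: \<eta>_def)
  have above: "x \<notin> A" if "\<eta> < x" for x
    using cSup_upper[OF _ bdd, of x] that by (auto simp: \<eta>_def)
  have inv: "(\<lambda>k. inverse (real (Suc k))) \<longlonglongrightarrow> 0" by (rule LIMSEQ_inverse_real_of_nat)
  have inv_dec: "inverse (real (Suc l)) \<le> inverse (real (Suc k))" if "k \<le> l" for k l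
    using that by (simp add: field_simps)
  \<comment> \<open>The double successor keeps all \<open>X k\<close> positive; with a single one
    \<open>X 0\<close> would be \<open>0\<close>.\<close>
  define X where "X k = \<eta> - \<eta> * inverse (real (Suc (Suc k)))" for k
  define Y where "Y k = \<eta> + inverse (real (Suc k))" for k
  have "X k \<in> A" for k
    using \<open>0 < \<eta>\<close> by (intro below) (auto simp: X_def field_simps intro!: add_pos_nonneg)
  have "0 < Y k" "Y k \<notin> A" for k
    using \<open>0 < \<eta>\<close> above[of "Y k"] by (auto simp: Y_def add_pos_pos)
  have "monoseq X"
    unfolding monoseq_def X_def using inv_dec \<open>0 < \<eta>\<close>
    by (intro disjI1 allI impI diff_left_mono mult_left_mono) auto
  moreover have "X \<longlonglongrightarrow> \<eta> - \<eta> * 0"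
    unfolding X_def[abs_def] using LIMSEQ_Suc[OF inv] by (intro tendsto_intros)
  ultimately obtain u1 v1 where 1: "truncated_solution p q \<xi> \<eta> u1 v1"
    "\<And>r. 0 \<le> r \<Longrightarrow> (\<lambda>k. ?u (X k) r) \<longlonglongrightarrow> u1 r" "\<And>r. 0 \<le> r \<Longrightarrow> (\<lambda>k. ?v (X k) r) \<longlonglongrightarrow> v1 r"
    using truncated_solution_monotone_limit[OF pq, of X \<eta> \<xi>] by auto
  have "monoseq Y"
    unfolding monoseq_def Y_def using inv_dec by (intro disjI2 allI impI add_left_mono) auto
  moreover have "Y \<longlonglongrightarrow> \<eta> + 0"
    unfolding Y_def[abs_def] using inv by (intro tendsto_intros)
  ultimately obtain u2 v2 where 2: "truncated_solution p q \<xi> \<eta> u2 v2"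
    "\<And>r. 0 \<le> r \<Longrightarrow> (\<lambda>k. ?u (Y k) r) \<longlonglongrightarrow> u2 r" "\<And>r. 0 \<le> r \<Longrightarrow> (\<lambda>k. ?v (Y k) r) \<longlonglongrightarrow> v2 r"
    using truncated_solution_monotone_limit[OF pq, of Y \<eta> \<xi>] by auto
  \<comment> \<open>By openness some \<open>X k\<close> would share this fate, although its selected
    solution loses \<open>v\<close> first.\<close>
  have "\<not> dies_before u1 v1"
  proof
    assume "dies_before u1 v1"
    then obtain r where r: "0 \<le> r" "u1 r < 0" "0 < v1 r" by (auto simp: dies_before_def)
    have "eventually (\<lambda>k. ?u (X k) r < 0 \<and> 0 < ?v (X k) r) sequentially"
      using order_tendstoD(2)[OF 1(2)[OF r(1)] r(2)] order_tendstoD(1)[OF 1(3)[OF r(1)] r(3)]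
      by (rule eventually_conj)
    then obtain k where "?u (X k) r < 0 \<and> 0 < ?v (X k) r"
      using eventually_happens'[OF sequentially_bot] by blast
    then have "dies_before (?u (X k)) (?v (X k))"
      using r(1) unfolding dies_before_def by blast
    then show False
      using \<open>X k \<in> A\<close> not_both_die_first[OF pq sol \<xi>] by (auto simp: A_def)
  qed
  then have "dies_before v1 u1" using fate[OF \<open>0 < \<eta>\<close> 1(1)] by simp
  \<comment> \<open>By openness this would put some \<open>Y k\<close> into \<open>A\<close>. So the
    left and right limits have the same data but opposite fates.\<close>
  moreover have "\<not> dies_before v2 u2"
  proof
    assume "dies_before v2 u2"
    then obtain r where r: "0 \<le> r" "v2 r < 0" "0 < u2 r" by (auto simp: dies_before_def)
    have "eventually (\<lambda>k. ?v (Y k) r < 0 \<and> 0 < ?u (Y k) r) sequentially"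
      using order_tendstoD(2)[OF 2(3)[OF r(1)] r(2)] order_tendstoD(1)[OF 2(2)[OF r(1)] r(3)]
      by (rule eventually_conj)
    then obtain k where "?v (Y k) r < 0 \<and> 0 < ?u (Y k) r"
      using eventually_happens'[OF sequentially_bot] by blast
    then have "dies_before (?v (Y k)) (?u (Y k))"
      using r(1) unfolding dies_before_def by blast
    then show False using \<open>Y k \<notin> A\<close> \<open>0 < Y k\<close> by (auto simp: A_def)
  qed
  then have "dies_before u2 v2" using fate[OF \<open>0 < \<eta>\<close> 2(1)] by simp
  ultimately show False
    using opposite_fates_impossible[OF pq \<xi> \<open>0 < \<eta>\<close> 1(1) 2(1)] by simp
qed

end

section \<open>The Pohozaev identity\<close>

locale convex_profile =
  fixes \<psi> \<psi>' :: "real \<Rightarrow> real" and n :: nat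
  assumes \<psi>_C1: "C1_halfline \<psi> \<psi>'" and \<psi>'_0: "\<psi>' 0 = 1"
    and \<psi>_pos: "0 < r \<Longrightarrow> 0 < \<psi> r" and \<psi>_0: "\<psi> 0 = 0"
    and \<psi>_convex: "convex_on {0..} \<psi>" and n_ge: "n \<ge> 2"
begin

section \<open>Consequences of convexity\<close>

lemma \<psi>_has_derivative: "0 < r \<Longrightarrow> (\<psi> has_real_derivative \<psi>' r) (at r)"
  using \<psi>_C1 by (auto simp: C1_halfline_def at_within_halfline dest: spec[of _ r])

lemma \<psi>_continuous: "continuous_on {0..} \<psi>" and \<psi>'_continuous: "continuous_on {0..} \<psi>'"
  using \<psi>_C1 by (auto simp: C1_halfline_def intro: has_derivative_imp_continuous_on_halfline)

lemma \<psi>_above_tangent: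
  assumes "0 < r" "0 \<le> s"
  shows "\<psi>' r * (s - r) \<le> \<psi> s - \<psi> r"
  using assms
  by (intro convex_on_imp_above_tangent[OF \<psi>_convex] has_field_derivative_at_within[OF \<psi>_has_derivative])
     (auto simp: interior_Ici)

text \<open>The tangent at \<open>r\<close> lies below the graph at the pole, where
  \<open>\<psi>\<close> vanishes; hence \<open>\<psi>' r * r \<ge> \<psi> r\<close>.\<close>

lemma \<psi>'_pos:
  assumes "0 < r"
  shows "0 < \<psi>' r"
proof -
  have "0 < \<psi>' r * r" using \<psi>_above_tangent[OF assms, of 0] \<psi>_pos[OF assms] by (simp add: \<psi>_0)
  then show ?thesis using assms by (simp add: zero_less_mult_iff)
qed

lemma \<psi>'_mono:
  assumes "0 < r" "r \<le> s"
  shows "\<psi>' r \<le> \<psi>' s"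
proof (cases "r = s")
  case False
  have "\<psi>' r * (s - r) \<le> \<psi>' s * (s - r)"
    using \<psi>_above_tangent[of r s] \<psi>_above_tangent[of s r] assms by (simp add: algebra_simps)
  then show ?thesis using False assms by simp
qed simp

lemma \<psi>_mono:
  assumes "0 \<le> r" "r \<le> s"
  shows "\<psi> r \<le> \<psi> s"
proof (rule DERIV_nonneg_imp_increasing_open[where f = \<psi>])
  show "continuous_on {r..s} \<psi>" using assms by (intro continuous_on_subset[OF \<psi>_continuous]) auto
  show "\<exists>y. (\<psi> has_real_derivative y) (at x) \<and> 0 \<le> y" if "r < x" for x
    using \<psi>_has_derivative[of x] \<psi>'_pos[of x] that assms by (intro exI[of _ "\<psi>' x"]) auto
qed fact

section \<open>Area density and volume of geodesic balls\<close>

definition area_density :: "real \<Rightarrow> real" where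
  "area_density r = \<psi> r ^ (n - 1)"

lemma area_density_pos: "0 < r \<Longrightarrow> 0 < area_density r"
  using \<psi>_pos by (simp add: area_density_def)

sublocale radial_weight area_density
proof
  show "continuous_on {0..} area_density"
    unfolding area_density_def[abs_def] by (intro continuous_intros \<psi>_continuous)
  show "area_density 0 = 0" using n_ge by (simp add: \<psi>_0 area_density_def)
  show "area_density r \<le> area_density s" if "0 \<le> r" "r \<le> s" for r s
    unfolding area_density_def
    using \<psi>_mono[OF that] \<psi>_mono[of 0 r] that by (intro power_mono) (auto simp: \<psi>_0)
qed (rule area_density_pos)

lemma area_density_mult: "area_density r * \<psi> r = \<psi> r ^ n"
  unfolding area_density_def using n_ge by (intro power_minus_mult) simp

lemma area_density_has_derivative:
  assumes "0 < r"
  shows "(area_density has_real_derivative area_density r * ((real n - 1) * \<psi>' r / \<psi> r)) (at r)"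
proof -
  have "(area_density has_real_derivative (n - 1) * (\<psi>' r * \<psi> r ^ (n - 1 - 1))) (at r)"
    unfolding area_density_def[abs_def]
    by (rule derivative_eq_intros \<psi>_has_derivative[OF assms] | simp add: mult_ac)+
  moreover have "\<psi> r ^ (n - 1 - 1) * \<psi> r = area_density r"
    unfolding area_density_def using n_ge by (intro power_minus_mult) simp
  then have "\<psi> r ^ (n - 1 - 1) = area_density r / \<psi> r"
    using \<psi>_pos[OF assms] by (simp add: field_simps)
  ultimately show ?thesis using n_ge by (simp add: of_nat_diff mult_ac)
qed

text \<open>The derivative \<open>n * area_density t * \<psi>' t\<close> of
  \<open>\<psi> t ^ n\<close> is at most \<open>n * area_density t * \<psi>' r\<close> for
  \<open>t \<le> r\<close>, and integrating gives the bound. Equality holds in the Euclidean case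
  \<open>\<psi> r = r\<close>.\<close>

lemma power_le_volume:
  assumes r: "0 < r"
  shows "\<psi> r ^ n \<le> n * \<psi>' r * wint (\<lambda>_. 1) r"
proof -
  have one: "continuous_on {0..} (\<lambda>_. 1::real)" by simp
  \<comment> \<open>The factor \<open>\<psi>' r\<close> is frozen at the right end, so
    \<open>\<psi>'\<close> is never differentiated.\<close>
  let ?f = "\<lambda>t. n * \<psi>' r * wint (\<lambda>_. 1) t - \<psi> t ^ n"
  have "?f 0 \<le> ?f r"
  proof (rule DERIV_nonneg_imp_increasing_open[of 0 r ?f])
    show "continuous_on {0..r} ?f"
      by (intro continuous_intros continuous_on_subset[OF wint_continuous[OF one]]
          continuous_on_subset[OF \<psi>_continuous]) auto
    fix t assume t: "0 < t" "t < r"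
    have "(?f has_real_derivative n * area_density t * (\<psi>' r - \<psi>' t)) (at t)"
      using wint_has_derivative[OF one, of t] \<psi>_has_derivative[of t] t
      by (auto simp: at_within_halfline area_density_def intro!: derivative_eq_intros simp: algebra_simps)
    moreover have "0 \<le> n * area_density t * (\<psi>' r - \<psi>' t)"
      using \<psi>'_mono[of t r] w_nonneg[of t] t by simp
    ultimately show "\<exists>y. (?f has_real_derivative y) (at t) \<and> 0 \<le> y" by blast
  qed (use r in simp)
  then show ?thesis using n_ge by (simp add: wint_0 \<psi>_0 power_0_left)
qed

text \<open>With \<open>wavg f = - u'\<close> this is the radial equation
  \<open>u'' + (n - 1) * \<psi>' / \<psi> * u' + f = 0\<close>.\<close>

lemma wavg_has_derivative:
  assumes "continuous_on {0..} f" "0 < r"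
  shows "(wavg f has_real_derivative f r - wavg f r * ((real n - 1) * \<psi>' r / \<psi> r)) (at r)"
proof -
  define D where "D = (real n - 1) * \<psi>' r / \<psi> r"
  have "(wint f has_real_derivative area_density r * f r) (at r)"
    using wint_has_derivative[of f r] assms by (simp add: at_within_halfline)
  moreover have "(area_density has_real_derivative area_density r * D) (at r)"
    using area_density_has_derivative[OF assms(2)] by (simp add: D_def)
  ultimately have "((\<lambda>r. wint f r / area_density r) has_real_derivative
      ((area_density r * f r) * area_density r - wint f r * (area_density r * D)) / (area_density r * area_density r)) (at r)"
    using area_density_pos[OF assms(2)] by (intro DERIV_divide) auto
  also have "((area_density r * f r) * area_density r - wint f r * (area_density r * D)) / (area_density r * area_density r)
      = f r - wavg f r * D"
    using area_density_pos[OF assms(2)] by (simp add: wavg_def diff_divide_distrib)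
  finally show ?thesis
    unfolding wavg_def[abs_def] D_def .
qed

lemma no_common_zero:
  assumes pq: "0 < p" "0 < q" and pos: "0 < \<xi>" "0 < \<eta>"
    and hyp: "1 / (p + 1) + 1 / (q + 1) \<le> (real n - 2) / real n"
    and sol: "truncated_solution p q \<xi> \<eta> u v"
    and R: "0 < R" "u R = 0" "v R = 0" "\<And>s. 0 \<le> s \<Longrightarrow> s < R \<Longrightarrow> 0 < u s \<and> 0 < v s"
  shows False
proof -
  have swap: "truncated_solution q p \<eta> \<xi> v u" using sol truncated_solution_swap by blast
  define f where "f = (\<lambda>s. pos_powr q (v s))"
  define g where "g = (\<lambda>s. pos_powr p (u s))"
  define a where "a = 1 / (q + 1)"
  define b where "b = 1 / (p + 1)"
  have uv: "continuous_on {0..} u" "continuous_on {0..} v"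
    using sol by (auto simp: truncated_solution_def)
  have fg: "continuous_on {0..} f" "continuous_on {0..} g"
    unfolding f_def g_def by (intro continuous_on_pos_powr pq uv)+
  have one: "continuous_on {0..} (\<lambda>_. 1::real)" by simp
  define V where "V = wint (\<lambda>_. 1)"
  \<comment> \<open>The Pohozaev quantity, with \<open>wavg f = - u'\<close>,
    \<open>wavg g = - v'\<close>, \<open>wint f = - w u'\<close> and \<open>wint g = - w v'\<close>;
    hence the minus sign before the last bracket.\<close>
  define P where "P r = V r * (b * u r powr (p + 1) + a * v r powr (q + 1) + wavg f r * wavg g r)
      - (a * (wint f r * v r) + b * (u r * wint g r))" for r
  have "P R \<le> P 0"
  proof (rule DERIV_nonpos_imp_decreasing_open[of 0 R P])
    have nonneg: "0 \<le> u r \<and> 0 \<le> v r" if "r \<in> {0..R}" for r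
      using R(2,3) R(4)[of r] that by (cases "r = R") auto
    have restrict: "continuous_on {0..R} h" if "continuous_on {0..} h" for h :: "real \<Rightarrow> real"
      using that by (rule continuous_on_subset) auto
    have "continuous_on {0..R} (\<lambda>r. u r powr (p + 1))" "continuous_on {0..R} (\<lambda>r. v r powr (q + 1))"
      using pq nonneg by (intro continuous_on_powr' continuous_on_const restrict[OF uv(1)] restrict[OF uv(2)]; auto)+
    then show "continuous_on {0..R} P"
      unfolding P_def[abs_def] V_def
      by (intro continuous_on_add continuous_on_diff continuous_on_mult continuous_on_const
          restrict[OF wint_continuous[OF one]] restrict[OF wint_continuous[OF fg(1)]]
          restrict[OF wint_continuous[OF fg(2)]] restrict[OF wavg_continuous[OF fg(1)]]
          restrict[OF wavg_continuous[OF fg(2)]] restrict[OF uv(1)] restrict[OF uv(2)])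
    fix r assume r: "0 < r" "r < R"
    define D where "D = (real n - 1) * \<psi>' r / \<psi> r"
    define F where "F = wavg f r"
    define G where "G = wavg g r"
    define W where "W = area_density r"
    have "0 < u r" "0 < v r" using R(4)[of r] r by auto
    have f: "f r = v r powr q" and g: "g r = u r powr p"
      using \<open>0 < u r\<close> \<open>0 < v r\<close> by (simp_all add: f_def g_def pos_powr_def)
    have "0 < W" unfolding W_def using w_pos[OF r(1)] .
    then have wint_eq: "wint f r = W * F" "wint g r = W * G"
      by (simp_all add: F_def G_def wavg_def W_def)
    have derivs: "(u has_real_derivative - F) (at r)" "(v has_real_derivative - G) (at r)"
      "(wavg f has_real_derivative f r - F * D) (at r)" "(wavg g has_real_derivative g r - G * D) (at r)"
      "(wint f has_real_derivative W * f r) (at r)" "(wint g has_real_derivative W * g r) (at r)"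
      "(V has_real_derivative W) (at r)"
      using truncated_solution_has_derivative[OF pq(2) sol, of r]
        truncated_solution_has_derivative[OF pq(1) swap, of r]
        wavg_has_derivative[OF fg(1) r(1)] wavg_has_derivative[OF fg(2) r(1)]
        wint_has_derivative[OF fg(1), of r] wint_has_derivative[OF fg(2), of r]
        wint_has_derivative[OF one, of r] r
      by (simp_all add: at_within_halfline F_def G_def f_def[symmetric] g_def[symmetric] D_def W_def V_def)
    have "(P has_real_derivative
        W * (b * u r powr (p + 1) + a * v r powr (q + 1) + F * G)
        + V r * (b * ((p + 1) * u r powr p * (- F)) + a * ((q + 1) * v r powr q * (- G))
            + ((f r - F * D) * G + F * (g r - G * D)))
        - (a * (W * f r * v r + wint f r * (- G)) + b * (- F * wint g r + u r * (W * g r)))) (at r)"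
    proof -
      have "((\<lambda>r. u r powr (p + 1)) has_real_derivative (p + 1) * u r powr p * (- F)) (at r)"
        using DERIV_chain2[OF has_real_derivative_powr[OF \<open>0 < u r\<close>, of "p + 1"] derivs(1)] by simp
      moreover
      have "((\<lambda>r. v r powr (q + 1)) has_real_derivative (q + 1) * v r powr q * (- G)) (at r)"
        using DERIV_chain2[OF has_real_derivative_powr[OF \<open>0 < v r\<close>, of "q + 1"] derivs(2)] by simp
      ultimately show ?thesis
        unfolding P_def[abs_def]
        by (intro DERIV_cong[OF DERIV_diff[OF DERIV_mult[OF derivs(7) DERIV_add[OF
                  DERIV_add[OF DERIV_cmult DERIV_cmult] DERIV_mult[OF derivs(3,4)]]]
                DERIV_add[OF DERIV_cmult[OF DERIV_mult[OF derivs(5,2)]]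
                  DERIV_cmult[OF DERIV_mult[OF derivs(1,6)]]]]])
           (auto simp: F_def G_def algebra_simps)
    qed
    \<comment> \<open>All terms containing \<open>f r\<close> or \<open>g r\<close> cancel: those
      with \<open>V\<close> among themselves, those with \<open>W\<close> against the last bracket.
      Only multiples of \<open>F * G\<close> remain.\<close>
    also have "W * (b * u r powr (p + 1) + a * v r powr (q + 1) + F * G)
        + V r * (b * ((p + 1) * u r powr p * (- F)) + a * ((q + 1) * v r powr q * (- G))
            + ((f r - F * D) * G + F * (g r - G * D)))
        - (a * (W * f r * v r + wint f r * (- G)) + b * (- F * wint g r + u r * (W * g r)))
      = F * G * ((1 + a + b) * W - 2 * V r * D)"
    proof -
      have "u r powr (p + 1) = u r * g r" "v r powr (q + 1) = v r * f r"
        using \<open>0 < u r\<close> \<open>0 < v r\<close> by (simp_all add: f g powr_add)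
      moreover have "b * ((p + 1) * u r powr p * (- F)) = - g r * F"
        "a * ((q + 1) * v r powr q * (- G)) = - f r * G"
        using pq by (simp_all add: f g a_def b_def)
      ultimately show ?thesis unfolding wint_eq by (simp add: algebra_simps)
    qed
    finally have deriv: "(P has_real_derivative F * G * ((1 + a + b) * W - 2 * V r * D)) (at r)" .
    \<comment> \<open>Adding \<open>1\<close> to the condition on the exponents gives
      \<open>1 + a + b \<le> 2 * (n - 1) / n\<close>.\<close>
    have "(1 + a + b) * W \<le> (2 * (real n - 1) / n) * W"
      using hyp n_ge \<open>0 < W\<close> by (intro mult_right_mono) (auto simp: a_def b_def field_simps)
    also have "\<dots> \<le> 2 * V r * D"
    proof -
      \<comment> \<open>Multiplied by \<open>2 * (n - 1) / n\<close> and divided by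
        \<open>\<psi> r\<close>, the volume comparison is the bound required.\<close>
      have "W * \<psi> r \<le> n * \<psi>' r * V r"
        using power_le_volume[OF r(1)] by (simp add: V_def W_def area_density_mult)
      then have "2 * (real n - 1) / n * (W * \<psi> r) \<le> 2 * (real n - 1) / n * (n * \<psi>' r * V r)"
        using n_ge by (intro mult_left_mono) auto
      also have "\<dots> = 2 * V r * D * \<psi> r"
        using \<psi>_pos[OF r(1)] n_ge by (simp add: D_def)
      finally have "2 * (real n - 1) / n * W * \<psi> r \<le> 2 * V r * D * \<psi> r" by (simp only: mult.assoc)
      then show ?thesis using \<psi>_pos[OF r(1)] by (rule mult_right_le_imp_le)
    qed
    finally have "(1 + a + b) * W - 2 * V r * D \<le> 0" by simp
    moreover have "0 \<le> F * G"
      unfolding F_def G_def f_def g_def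
      using truncated_solution_wavg_pos[OF pq(2) sol pos(2) r(1)]
        truncated_solution_wavg_pos[OF pq(1) swap pos(1) r(1)] by simp
    ultimately show "\<exists>y. (P has_real_derivative y) (at r) \<and> y \<le> 0"
      using deriv by (intro exI conjI) (auto intro: mult_nonneg_nonpos)
  qed (use R in simp)
  moreover have "P 0 = 0" by (simp add: P_def V_def wint_0)
  \<comment> \<open>At the common zero only the term \<open>V u' v'\<close> survives, and both
    derivatives are negative.\<close>
  moreover have "0 < P R"
  proof -
    have "0 < V R"
      using wavg_pos[OF one R(1)] w_pos[OF R(1)] by (simp add: V_def wavg_def zero_less_divide_iff)
    then show ?thesis
      using truncated_solution_wavg_pos[OF pq(2) sol pos(2) R(1)]
        truncated_solution_wavg_pos[OF pq(1) swap pos(1) R(1)] R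
      by (simp add: P_def f_def g_def)
  qed
  ultimately show False by simp
qed

section \<open>Limits at the pole and the return to the Cauchy problem\<close>

lemma \<psi>_over_id_tendsto: "((\<lambda>r. \<psi> r / r) \<longlongrightarrow> 1) (at_right 0)"
proof -
  have "(\<psi> has_real_derivative 1) (at 0 within {0..})"
    using \<psi>_C1 \<psi>'_0 by (auto simp: C1_halfline_def dest: spec[of _ 0])
  then have "((\<lambda>r. \<psi> r / r) \<longlongrightarrow> 1) (at 0 within {0..})"
    by (simp add: has_field_derivative_iff \<psi>_0)
  then show ?thesis by (rule tendsto_within_subset) auto
qed

text \<open>By l'Hopital's rule the limit is that of
  \<open>(\<psi> r / r) ^ (n - 1) * f r / n\<close>, and \<open>\<psi> r / r\<close> tends to
  \<open>\<psi>' 0 = 1\<close>.\<close>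

lemma wint_over_power_tendsto:
  assumes "continuous_on {0..} f"
  shows "((\<lambda>r. wint f r / r ^ n) \<longlongrightarrow> f 0 / n) (at_right 0)"
proof (rule lhopital_right_0)
  show "(wint f \<longlongrightarrow> 0) (at_right 0)"
    using halfline_tendsto_right[OF wint_continuous[OF assms]] by (simp add: wint_0)
  show "((\<lambda>r. r ^ n) \<longlongrightarrow> 0) (at_right (0::real))"
    using n_ge by (auto intro!: tendsto_eq_intros)
  show "\<forall>\<^sub>F r in at_right 0. r ^ n \<noteq> (0::real)"
    unfolding eventually_at_right_field by (intro exI[of _ 1]) auto
  show "\<forall>\<^sub>F r in at_right 0. real n * r ^ (n - 1) \<noteq> (0::real)"
    unfolding eventually_at_right_field using n_ge by (intro exI[of _ 1]) auto
  show "\<forall>\<^sub>F r in at_right 0. (wint f has_real_derivative area_density r * f r) (at r)"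
    unfolding eventually_at_right_field using wint_has_derivative[OF assms]
    by (intro exI[of _ 1]) (auto simp: at_within_halfline[symmetric])
  show "\<forall>\<^sub>F r in at_right 0. ((\<lambda>r. r ^ n) has_real_derivative real n * r ^ (n - 1)) (at r)"
    by (auto intro!: always_eventually derivative_eq_intros)
  have "((\<lambda>r. (\<psi> r / r) ^ (n - 1) * f r / n) \<longlongrightarrow> 1 ^ (n - 1) * f 0 / n) (at_right 0)"
    using n_ge by (intro tendsto_intros \<psi>_over_id_tendsto halfline_tendsto_right[OF assms]) auto
  then show "((\<lambda>r. area_density r * f r / (real n * r ^ (n - 1))) \<longlongrightarrow> f 0 / n) (at_right 0)"
    by (simp add: power_divide area_density_def mult_ac)
qed

text \<open>Since \<open>area_density r / r ^ (n - 1)\<close> tends to \<open>1\<close>, the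
  previous limit is unchanged. For \<open>wavg f = - u'\<close> it is the Euclidean value of
  \<open>- u''\<close> at the pole.\<close>

lemma wavg_over_id_tendsto:
  assumes "continuous_on {0..} f"
  shows "((\<lambda>r. wavg f r / r) \<longlongrightarrow> f 0 / n) (at_right 0)"
proof -
  have "((\<lambda>r. (wint f r / r ^ n) / (\<psi> r / r) ^ (n - 1)) \<longlongrightarrow> (f 0 / n) / 1 ^ (n - 1)) (at_right 0)"
    by (intro tendsto_intros wint_over_power_tendsto[OF assms] \<psi>_over_id_tendsto) auto
  then have "((\<lambda>r. (wint f r / r ^ n) / (\<psi> r / r) ^ (n - 1)) \<longlongrightarrow> f 0 / n) (at_right 0)" by simp
  moreover have "(wint f r / r ^ n) / (\<psi> r / r) ^ (n - 1) = wavg f r / r" if "0 < r" for r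
  proof -
    have "r ^ n = r * r ^ (n - 1)" using n_ge by (cases n) auto
    moreover have "(\<psi> r / r) ^ (n - 1) = area_density r / r ^ (n - 1)"
      by (simp add: power_divide area_density_def)
    ultimately show ?thesis using that area_density_pos[OF that] by (simp add: wavg_def field_simps)
  qed
  ultimately show ?thesis
    by (elim Lim_transform_eventually) (auto simp: eventually_at_right_field intro!: exI[of _ 1])
qed

lemma truncated_solution_imp_CP:
  assumes pq: "0 < p" "0 < q" and sol: "truncated_solution p q \<xi> \<eta> u v"
    and pos: "\<And>r. 0 \<le> r \<Longrightarrow> 0 < u r \<and> 0 < v r"
  shows "globally_positive_solution n \<psi> p q \<xi> \<eta> u v"
proof -
  \<comment> \<open>One equation for arbitrary data; the other one is obtained by exchanging the
    components.\<close>
  have component: "C1_halfline u (\<lambda>r. - wavg f r) \<and>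
      (\<forall>r>0. ((\<lambda>r. - wavg f r) has_real_derivative - (f r - wavg f r * ((real n - 1) * \<psi>' r / \<psi> r))) (at r)) \<and>
      continuous_on {0<..} (\<lambda>r. - (f r - wavg f r * ((real n - 1) * \<psi>' r / \<psi> r))) \<and>
      (\<forall>r>0. ((\<lambda>s. \<psi> s ^ (n - 1) * - wavg f s) has_real_derivative
         - (\<psi> r ^ (n - 1) * (\<bar>v r\<bar> powr (q - 1) * v r))) (at r))"
    if q: "0 < q" and sol: "truncated_solution p q \<xi> \<eta> u v" and pos: "\<And>r. 0 \<le> r \<Longrightarrow> 0 < v r"
      and f_def: "f = (\<lambda>s. pos_powr q (v s))" for p q \<xi> \<eta> u v f
  proof (intro conjI allI impI)
    have f: "continuous_on {0..} f"
      unfolding f_def using q sol by (intro continuous_on_pos_powr) (auto simp: truncated_solution_def)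
    show "C1_halfline u (\<lambda>r. - wavg f r)"
      unfolding C1_halfline_def
      using truncated_solution_has_derivative[OF q sol] continuous_on_minus[OF wavg_continuous[OF f]]
      by (simp add: f_def)
    show "continuous_on {0<..} (\<lambda>r. - (f r - wavg f r * ((real n - 1) * \<psi>' r / \<psi> r)))"
    proof -
      have restrict: "continuous_on {0<..} h" if "continuous_on {0..} h" for h :: "real \<Rightarrow> real"
        using that by (rule continuous_on_subset) auto
      have "\<forall>r\<in>{0<..}. \<psi> r \<noteq> 0" using \<psi>_pos by force
      then show ?thesis
        by (intro continuous_on_minus continuous_on_diff continuous_on_mult continuous_on_divide
            continuous_on_const restrict[OF f] restrict[OF wavg_continuous[OF f]]
            restrict[OF \<psi>'_continuous] restrict[OF \<psi>_continuous])
    qed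
    fix r :: real assume r: "0 < r"
    show "((\<lambda>r. - wavg f r) has_real_derivative - (f r - wavg f r * ((real n - 1) * \<psi>' r / \<psi> r))) (at r)"
      using wavg_has_derivative[OF f r] by (rule DERIV_minus)
    have "((\<lambda>s. - wint f s) has_real_derivative - (area_density r * f r)) (at r)"
      using DERIV_minus[OF wint_has_derivative[OF f, of r]] r by (simp add: at_within_halfline)
    \<comment> \<open>For positive radii the product is \<open>- wint f\<close>, so no product rule
      is needed.\<close>
    then have "((\<lambda>s. \<psi> s ^ (n - 1) * - wavg f s) has_real_derivative - (area_density r * f r)) (at r)"
    proof (rule has_field_derivative_transform_within_open[OF _ open_greaterThan[of 0]])
      show "- wint f s = \<psi> s ^ (n - 1) * - wavg f s" if "s \<in> {0<..}" for s
        using that area_density_pos[of s] by (simp only: area_density_def[symmetric] wavg_def) simp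
    qed (use r in simp)
    moreover have "f r = \<bar>v r\<bar> powr (q - 1) * v r"
      using pos[of r] r powr_add[of "v r" "q - 1" 1] by (simp add: f_def pos_powr_def)
    ultimately show "((\<lambda>s. \<psi> s ^ (n - 1) * - wavg f s) has_real_derivative
         - (\<psi> r ^ (n - 1) * (\<bar>v r\<bar> powr (q - 1) * v r))) (at r)"
      by (simp add: area_density_def)
  qed
  have swap: "truncated_solution q p \<eta> \<xi> v u" using sol truncated_solution_swap by blast
  let ?u' = "\<lambda>r. - wavg (\<lambda>s. pos_powr q (v s)) r"
  let ?v' = "\<lambda>r. - wavg (\<lambda>s. pos_powr p (u s)) r"
  let ?D = "\<lambda>r. (real n - 1) * \<psi>' r / \<psi> r"
  have pos_uv: "\<And>r. 0 \<le> r \<Longrightarrow> 0 < u r" "\<And>r. 0 \<le> r \<Longrightarrow> 0 < v r" using pos by auto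
  have "?u' 0 = 0" "?v' 0 = 0" by (simp_all add: wavg_0)
  moreover note component[OF pq(2) sol pos_uv(2) refl] component[OF pq(1) swap pos_uv(1) refl]
    truncated_solution_0[OF sol]
  ultimately have "CP_global_solution n \<psi> p q \<xi> \<eta> u v"
    unfolding CP_global_solution_def
    by - (rule exI[of _ ?u'], rule exI[of _ ?v'],
        rule exI[of _ "\<lambda>r. - (pos_powr q (v r) - wavg (\<lambda>s. pos_powr q (v s)) r * ?D r)"],
        rule exI[of _ "\<lambda>r. - (pos_powr p (u r) - wavg (\<lambda>s. pos_powr p (u s)) r * ?D r)"], blast)
  then show ?thesis using pos by (simp add: globally_positive_solution_def)
qed

end

section \<open>Radial functions and the model metric\<close>

lemma inner_axis_one: "(x::real^'n) \<bullet> axis i 1 = x $ i"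
  by (simp add: cart_eq_inner_axis)

lemma axis_component: "axis j (1::real) $ i = (if i = j then 1 else 0)"
  by (simp add: axis_def)

lemma partial_deriv_eq:
  "(f has_derivative D) (at x) \<Longrightarrow> partial_deriv i f x = D (axis i 1)"
  unfolding partial_deriv_def using frechet_derivative_at by metis

lemma has_derivative_component: "((\<lambda>x::real^'n. x $ i) has_derivative (\<lambda>h. h $ i)) (at x)"
  by (intro bounded_linear_imp_has_derivative bounded_linear_vec_nth)

lemma tendsto_norm_at_right: "filterlim (norm :: real^'n \<Rightarrow> real) (at_right 0) (at 0)"
  unfolding filterlim_at
  by (auto intro!: tendsto_eq_intros always_eventually simp: eventually_at_filter)

lemma continuous_halfline_norm:
  assumes "continuous_on {0..} g"
  shows "continuous_on UNIV (\<lambda>x::real^'n. g (norm x))"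
  by (rule continuous_on_compose2[OF assms]) (auto intro: continuous_intros)

text \<open>Writing the derivative of the profile as \<open>r * g r\<close> turns the gradient into
  \<open>g (norm x)\<close> times \<open>x\<close>, which avoids the unit vector that is singular at
  the origin.\<close>

lemma radial_has_derivative:
  fixes x :: "real^'n"
  assumes f: "\<And>r. 0 \<le> r \<Longrightarrow> (f has_real_derivative r * g r) (at r within {0..})"
  shows "((\<lambda>x. f (norm x)) has_derivative (\<lambda>h. g (norm x) * (x \<bullet> h))) (at x)"
proof (cases "x = 0")
  case False
  then have "(f has_real_derivative norm x * g (norm x)) (at (norm x))"
    using f[of "norm x"] at_within_interior[of "norm x" "{0..}"] by (simp add: interior_Ici)
  then have "((\<lambda>x. f (norm x)) has_derivative (\<lambda>h. (norm x * g (norm x)) * (h \<bullet> sgn x))) (at x)"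
    using has_derivative_compose[OF has_derivative_norm[OF False]]
    by (simp add: has_field_derivative_def)
  moreover have "(norm x * g (norm x)) * (h \<bullet> sgn x) = g (norm x) * (x \<bullet> h)" for h
    using False by (simp add: sgn_div_norm inner_commute)
  ultimately show ?thesis by simp
next
  case True
  have "((\<lambda>r. (f r - f 0) / r) \<longlongrightarrow> 0) (at_right 0)"
    using f[of 0] by (auto simp: has_field_derivative_iff intro: tendsto_within_subset)
  then have "((\<lambda>y::real^'n. (f (norm y) - f 0) / norm y) \<longlongrightarrow> 0) (at 0)"
    by (rule filterlim_compose[OF _ tendsto_norm_at_right])
  then show ?thesis
    unfolding True has_derivative_iff_norm
    by (auto dest: tendsto_norm_zero)
qed

text \<open>Conditions making the field \<open>g (norm x) *\<^sub>R x\<close> continuously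
  differentiable across the origin. Its partial derivatives contain
  \<open>g' r / r * x $ j * x $ i\<close>, which is at most \<open>r * \<bar>g' r\<bar>\<close>; so
  \<open>g'\<close> itself may lack a limit at \<open>0\<close>.\<close>

locale radial_coefficient =
  fixes g g' :: "real \<Rightarrow> real"
  assumes g_continuous: "continuous_on {0..} g"
    and g_has_derivative: "0 < r \<Longrightarrow> (g has_real_derivative g' r) (at r)"
    and g'_continuous: "continuous_on {0<..} g'"
    and g'_limit: "((\<lambda>r. r * g' r) \<longlongrightarrow> 0) (at_right 0)"
begin

lemma component_has_derivative:
  fixes x :: "real^'n"
  shows "((\<lambda>x. g (norm x) * x $ i) has_derivative
    (\<lambda>h. g (norm x) * h $ i + g' (norm x) / norm x * (x \<bullet> h) * x $ i)) (at x)"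
proof (cases "x = 0")
  case False
  then have "((\<lambda>x. g (norm x)) has_derivative (\<lambda>h. g' (norm x) * (h \<bullet> sgn x))) (at x)"
    using has_derivative_compose[OF has_derivative_norm[OF False]] g_has_derivative[of "norm x"]
    by (simp add: has_field_derivative_def)
  from has_derivative_mult[OF this has_derivative_component]
  show ?thesis
    by (rule has_derivative_eq_rhs) (simp add: fun_eq_iff sgn_div_norm inner_commute field_simps)
next
  case True
  have lim: "((\<lambda>y::real^'n. g (norm y) - g 0) \<longlongrightarrow> 0) (at 0)"
  proof -
    have "((\<lambda>y::real^'n. g (norm y)) \<longlongrightarrow> g (norm (0::real^'n))) (at 0)"
      using continuous_halfline_norm[OF g_continuous]
      unfolding continuous_on_def by blast
    then show ?thesis by (intro LIM_zero) simp
  qed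
  \<comment> \<open>As \<open>\<bar>y $ i\<bar> \<le> norm y\<close>, the quotient is controlled by
    the continuity of \<open>g\<close> at \<open>0\<close>.\<close>
  have "((\<lambda>y. norm (g (norm y) * y $ i - g 0 * y $ i) / norm y) \<longlongrightarrow> 0) (at 0)"
  proof (rule Lim_null_comparison[OF _ tendsto_norm_zero[OF lim]], intro always_eventually allI)
    fix y :: "real^'n"
    have "\<bar>g (norm y) - g 0\<bar> * \<bar>y $ i\<bar> \<le> \<bar>g (norm y) - g 0\<bar> * norm y"
      by (intro mult_left_mono component_le_norm_cart) auto
    then show "norm (norm (g (norm y) * y $ i - g 0 * y $ i) / norm y) \<le> norm (g (norm y) - g 0)"
      by (cases "y = 0") (auto simp: abs_mult left_diff_distrib[symmetric] divide_le_eq)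
  qed
  moreover have "bounded_linear (\<lambda>h::real^'n. g 0 * h $ i)"
    by (intro bounded_linear_const_mult bounded_linear_vec_nth)
  ultimately show ?thesis unfolding True has_derivative_iff_norm by simp
qed

lemma partial_deriv_component:
  "partial_deriv j (\<lambda>x. g (norm x) * x $ i) (x::real^'n)
    = g (norm x) * (if i = j then 1 else 0) + g' (norm x) / norm x * x $ j * x $ i"
  by (subst partial_deriv_eq[OF component_has_derivative]) (simp add: inner_axis_one axis_component)

lemma C1_component: "C1_function (\<lambda>x::real^'n. g (norm x) * x $ i)"
  unfolding C1_function_def
proof (intro conjI allI)
  show "(\<lambda>x::real^'n. g (norm x) * x $ i) differentiable (at x)" for x
    using component_has_derivative differentiableI by blast
  fix j
  have "((\<lambda>x::real^'n. g' (norm x) / norm x * x $ j * x $ i) \<longlongrightarrow> g' (norm x) / norm x * x $ j * x $ i) (at x)"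
    for x :: "real^'n"
  proof (cases "x = 0")
    case False
    then have "isCont g' (norm x)"
      using g'_continuous by (simp add: continuous_on_eq_continuous_at)
    moreover have "((\<lambda>y. norm y) \<longlongrightarrow> norm x) (at x)" by (intro tendsto_intros)
    ultimately have "((\<lambda>y. g' (norm y)) \<longlongrightarrow> g' (norm x)) (at x)"
      by (rule isCont_tendsto_compose)
    then show ?thesis using False by (intro tendsto_intros) auto
  next
    case True
    have lim: "((\<lambda>y::real^'n. norm y * g' (norm y)) \<longlongrightarrow> 0) (at 0)"
      using filterlim_compose[OF g'_limit tendsto_norm_at_right] .
    have "((\<lambda>y::real^'n. g' (norm y) / norm y * y $ j * y $ i) \<longlongrightarrow> 0) (at 0)"
    proof (rule Lim_null_comparison[OF _ tendsto_norm_zero[OF lim]], intro always_eventually allI)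
      fix y :: "real^'n"
      have "\<bar>g' (norm y)\<bar> * (\<bar>y $ j\<bar> * \<bar>y $ i\<bar>) \<le> \<bar>g' (norm y)\<bar> * (norm y * norm y)"
        by (intro mult_left_mono mult_mono component_le_norm_cart) auto
      then show "norm (g' (norm y) / norm y * y $ j * y $ i) \<le> norm (norm y * g' (norm y))"
        by (cases "y = 0") (auto simp: abs_mult divide_le_eq mult_ac)
    qed
    then show ?thesis by (simp add: True)
  qed
  then have "continuous_on UNIV (\<lambda>x::real^'n. g' (norm x) / norm x * x $ j * x $ i)"
    by (simp add: continuous_on_def)
  then show "continuous_on UNIV (partial_deriv j (\<lambda>x::real^'n. g (norm x) * x $ i))"
    unfolding partial_deriv_component
    by (rule continuous_on_add[OF continuous_on_mult[OF continuous_halfline_norm[OF g_continuous]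
            continuous_on_const]])
qed

lemma radial_gradient:
  assumes "\<And>r. 0 \<le> r \<Longrightarrow> (f has_real_derivative r * g r) (at r within {0..})"
  shows "partial_deriv i (\<lambda>x::real^'n. f (norm x)) = (\<lambda>x. g (norm x) * x $ i)"
  by (rule ext, subst partial_deriv_eq[OF radial_has_derivative[OF assms]])
     (auto simp: inner_axis_one)

text \<open>The components of the gradient have the form treated in
  \<open>C1_component\<close>.\<close>

lemma radial_C2:
  assumes "\<And>r. 0 \<le> r \<Longrightarrow> (f has_real_derivative r * g r) (at r within {0..})"
  shows "C2_function (\<lambda>x::real^'n. f (norm x))"
proof -
  have "(\<lambda>x::real^'n. f (norm x)) differentiable (at x)" for x
    using radial_has_derivative[OF assms] differentiableI by blast
  moreover have "continuous_on UNIV (\<lambda>x::real^'n. g (norm x) * x $ i)" for i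
    by (intro continuous_on_mult continuous_halfline_norm[OF g_continuous]
        linear_continuous_on bounded_linear_vec_nth)
  ultimately show ?thesis
    unfolding C2_function_def C1_function_def[of "\<lambda>x. f (norm x)"]
    by (simp add: radial_gradient[OF assms] C1_component)
qed

lemma divergence:
  "(\<Sum>i\<in>UNIV. partial_deriv i (\<lambda>x. g (norm x) * x $ i) (x::real^'n))
    = CARD('n) * g (norm x) + norm x * g' (norm x)"
proof (cases "x = 0")
  case False
  have "(\<Sum>i\<in>UNIV. g' (norm x) / norm x * x $ i * x $ i) = g' (norm x) / norm x * (norm x)\<^sup>2"
    by (simp add: norm_vec_def L2_set_def sum_nonneg sum_distrib_left power2_eq_square mult.assoc)
  then show ?thesis using False by (simp add: partial_deriv_component sum.distrib power2_eq_square)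
qed (simp add: partial_deriv_component)

end

lemma model_metric_mult_self: "model_metric \<psi> x *v x = (x::real^'n)"
proof (cases "x = 0")
  case False
  have sq: "(\<Sum>j\<in>UNIV. x $ j * x $ j) = (norm x)\<^sup>2"
    by (simp add: norm_vec_def L2_set_def sum_nonneg power2_eq_square)
  let ?c = "(\<psi> (norm x) / norm x)\<^sup>2"
  have "(model_metric \<psi> x *v x) $ i = x $ i" for i
  proof -
    \<comment> \<open>The entries of the metric are \<open>?c\<close> on the diagonal plus
      \<open>(1 - ?c) * x $ i * x $ j / (norm x)\<^sup>2\<close>; \<open>K\<close> collects what
      does not depend on \<open>j\<close>. Radial vectors are thus fixed.\<close>
    define K where "K = (1 - ?c) * (x $ i / (norm x)\<^sup>2)"
    have "(model_metric \<psi> x *v x) $ i = (\<Sum>j\<in>UNIV. K * (x $ j * x $ j)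
        + ?c * (if i = j then x $ j else 0))"
      unfolding matrix_vector_mult_def using False
      by (auto simp: model_metric_def K_def diff_divide_distrib algebra_simps intro!: sum.cong)
    also have "\<dots> = K * (norm x)\<^sup>2 + ?c * x $ i"
      by (simp add: sum.distrib sum_distrib_left[symmetric] sq)
    also have "\<dots> = x $ i" using False by (simp add: K_def algebra_simps)
    finally show ?thesis .
  qed
  then show ?thesis by (simp add: vec_eq_iff)
qed simp

text \<open>A rotation taking a basis vector to the radial direction diagonalizes the metric: the
  eigenvalue is \<open>1\<close> radially and \<open>?c\<close> on the \<open>CARD('n) - 1\<close>
  tangential directions.\<close>

lemma det_model_metric:
  assumes "x \<noteq> 0"
  shows "det (model_metric \<psi> x :: real^'n^'n) = ((\<psi> (norm x) / norm x)\<^sup>2) ^ (CARD('n) - 1)"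
proof -
  let ?c = "(\<psi> (norm x) / norm x)\<^sup>2"
  obtain k :: 'n where True by simp
  have "norm (x /\<^sub>R norm x) = 1" using assms by simp
  then obtain A where A: "orthogonal_matrix A" "A *v axis k 1 = x /\<^sub>R norm x"
    using orthogonal_matrix_exists_basis by metis
  define D :: "real^'n^'n" where "D = (\<chi> i j. if i = j then if i = k then 1 else ?c else 0)"
  have col: "A $ i $ k = x $ i / norm x" for i
  proof -
    have "(A *v axis k 1) $ i = A $ i $ k"
      by (simp add: matrix_vector_mult_def axis_def if_distrib cong: if_cong)
    then show ?thesis using A(2) by (simp add: divide_inverse mult.commute)
  qed
  have rows: "(\<Sum>m\<in>UNIV. A $ i $ m * A $ j $ m) = (if i = j then 1 else 0)" for i j
  proof -
    have "(A ** transpose A) $ i $ j = mat 1 $ i $ j" using A(1) by (simp add: orthogonal_matrix_def)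
    then show ?thesis by (simp add: matrix_matrix_mult_def transpose_def mat_def)
  qed
  \<comment> \<open>Since \<open>D\<close> differs from \<open>?c\<close> times the identity only at
    \<open>k\<close>, the product is \<open>?c\<close> times the identity plus \<open>1 - ?c\<close>
    times the projection onto column \<open>k\<close> of \<open>A\<close>, the radial
    direction.\<close>
  have "model_metric \<psi> x = A ** D ** transpose A"
  proof -
    have "(A ** D) $ i $ m = A $ i $ m * (if m = k then 1 else ?c)" for i m
      by (simp add: matrix_matrix_mult_def D_def if_distrib cong: if_cong)
    then have "(A ** D ** transpose A) $ i $ j
        = (\<Sum>m\<in>UNIV. ?c * (A $ i $ m * A $ j $ m) + (if m = k then (1 - ?c) * (A $ i $ k * A $ j $ k) else 0))"
      for i j
      by (subst matrix_matrix_mult_def) (auto simp: transpose_def algebra_simps intro!: sum.cong)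
    then have "(A ** D ** transpose A) $ i $ j
        = ?c * (if i = j then 1 else 0) + (1 - ?c) * (A $ i $ k * A $ j $ k)" for i j
      by (simp add: sum.distrib sum_distrib_left[symmetric] rows)
    moreover have "?c * (if i = j then 1 else 0) + (1 - ?c) * (A $ i $ k * A $ j $ k)
        = model_metric \<psi> x $ i $ j" for i j
      using assms by (simp add: model_metric_def col power2_eq_square algebra_simps)
    ultimately show ?thesis by (simp add: vec_eq_iff)
  qed
  then have "det (model_metric \<psi> x) = det (A ** transpose A) * det D"
    by (simp add: det_mul)
  also have "\<dots> = det D" using A(1) by (simp add: orthogonal_matrix_def)
  also have "\<dots> = (\<Prod>i\<in>UNIV. if i = k then 1 else ?c)"
    by (subst det_diagonal) (auto simp: D_def)
  also have "\<dots> = (\<Prod>i\<in>UNIV - {k}. ?c)"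
    by (subst prod.remove[of _ k]) (auto intro!: prod.cong)
  also have "\<dots> = ?c ^ (CARD('n) - 1)" by simp
  finally show ?thesis .
qed

lemma matrix_inv_mult_fixed:
  fixes A :: "real^'n^'n"
  assumes "invertible A" "A *v x = x"
  shows "matrix_inv A *v x = x"
proof -
  have "matrix_inv A ** A = mat 1"
    using someI_ex[OF assms(1)[unfolded invertible_def]] by (simp add: matrix_inv_def)
  then have "matrix_inv A *v (A *v x) = x" by (simp add: matrix_vector_mul_assoc)
  then show ?thesis using assms(2) by simp
qed

section \<open>Gradient and flux coefficients up to the pole\<close>

lemma continuous_on_halfline_patch:
  fixes g :: "real \<Rightarrow> real"
  assumes "\<And>r. 0 < r \<Longrightarrow> (g has_real_derivative g' r) (at r)" "(g \<longlongrightarrow> a) (at_right 0)"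
  shows "continuous_on {0..} (\<lambda>r. if r = 0 then a else g r)"
  unfolding continuous_on_def
proof
  fix r :: real assume "r \<in> {0..}"
  then consider "r = 0" | "0 < r" by force
  then show "((\<lambda>r. if r = 0 then a else g r) \<longlongrightarrow> (if r = 0 then a else g r)) (at r within {0..})"
  proof cases
    case 1
    have "((\<lambda>r. if r = 0 then a else g r) \<longlongrightarrow> a) (at_right 0)"
      using assms(2) by (rule Lim_transform_eventually) (auto simp: eventually_at_filter)
    moreover have "at_right 0 = at (0::real) within {0..}"
      by (rule at_within_nhd[of _ UNIV]) auto
    ultimately show ?thesis by (simp add: 1)
  next
    case 2
    have "(g \<longlongrightarrow> g r) (at r)" using DERIV_isCont[OF assms(1)[OF 2]] by (simp add: isCont_def)
    then have "((\<lambda>r. if r = 0 then a else g r) \<longlongrightarrow> g r) (at r)"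
      by (rule Lim_transform_within_open[of _ _ _ UNIV "{0<..}"]) (use 2 in auto)
    then show ?thesis using 2 by (auto intro: tendsto_within_subset)
  qed
qed

lemma radial_coefficient_patch:
  assumes "\<And>r. 0 < r \<Longrightarrow> (g has_real_derivative g' r) (at r)" "(g \<longlongrightarrow> a) (at_right 0)"
    and "continuous_on {0<..} g'" "((\<lambda>r. r * g' r) \<longlongrightarrow> 0) (at_right 0)"
  shows "radial_coefficient (\<lambda>r. if r = 0 then a else g r) g'"
proof
  show "continuous_on {0..} (\<lambda>r. if r = 0 then a else g r)"
    by (rule continuous_on_halfline_patch[OF assms(1,2)])
  show "((\<lambda>r. if r = 0 then a else g r) has_real_derivative g' r) (at r)" if "0 < r" for r
    by (rule has_field_derivative_transform_within_open[OF assms(1)[OF that] open_greaterThan[of 0]])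
       (use that in auto)
qed fact+

context convex_profile
begin

text \<open>For \<open>u' = - wavg f\<close> this is the coefficient \<open>u' / r\<close> of the
  gradient. The product of \<open>r\<close> and its derivative is \<open>u'' - u' / r\<close>, and
  both terms tend to \<open>- f 0 / n\<close>, using \<open>\<psi>' 0 = 1\<close>.\<close>

lemma gradient_coefficient:
  assumes f: "continuous_on {0..} f"
  shows "radial_coefficient (\<lambda>r. if r = 0 then - f 0 / n else - wavg f r / r)
    (\<lambda>r. - (f r - wavg f r * ((real n - 1) * \<psi>' r / \<psi> r)) / r + wavg f r / r\<^sup>2)"
    (is "radial_coefficient _ ?g'")
proof (rule radial_coefficient_patch)
  show "((\<lambda>r. - wavg f r / r) has_real_derivative ?g' r) (at r)" if r: "0 < r" for r
    using r by (auto intro!: derivative_eq_intros wavg_has_derivative[OF f] simp: power2_eq_square field_simps)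
  show "((\<lambda>r. - wavg f r / r) \<longlongrightarrow> - f 0 / n) (at_right 0)"
    using tendsto_minus[OF wavg_over_id_tendsto[OF f]] by simp
  have "\<forall>r\<in>{0<..}. \<psi> r \<noteq> 0" "\<forall>r\<in>{0<..}. r\<^sup>2 \<noteq> (0::real)" "\<forall>r\<in>{0<..}. r \<noteq> (0::real)"
    using \<psi>_pos by force+
  then show "continuous_on {0<..} ?g'"
    by (intro continuous_on_add continuous_on_minus continuous_on_diff continuous_on_mult
        continuous_on_divide continuous_on_const continuous_on_power continuous_on_id
        halfline_continuous_open f wavg_continuous \<psi>'_continuous \<psi>_continuous)
  have "((\<lambda>r. - (f r - (wavg f r / r) * ((real n - 1) * \<psi>' r / (\<psi> r / r))) + wavg f r / r)
      \<longlongrightarrow> - (f 0 - (f 0 / n) * ((real n - 1) * \<psi>' 0 / 1)) + f 0 / n) (at_right 0)"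
    by (intro tendsto_intros halfline_tendsto_right f \<psi>'_continuous wavg_over_id_tendsto \<psi>_over_id_tendsto) auto
  also have "- (f 0 - (f 0 / n) * ((real n - 1) * \<psi>' 0 / 1)) + f 0 / n = 0"
    using n_ge by (simp add: \<psi>'_0 field_simps)
  finally show "((\<lambda>r. r * ?g' r) \<longlongrightarrow> 0) (at_right 0)"
  proof (rule Lim_transform_eventually)
    have "- (f r - (wavg f r / r) * ((real n - 1) * \<psi>' r / (\<psi> r / r))) + wavg f r / r = r * ?g' r"
      if "0 < r" for r using that \<psi>_pos[OF that] by (simp add: field_simps power2_eq_square)
    then show "\<forall>\<^sub>F r in at_right 0.
        - (f r - (wavg f r / r) * ((real n - 1) * \<psi>' r / (\<psi> r / r))) + wavg f r / r = r * ?g' r"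
      by (auto simp: eventually_at_filter)
  qed
qed

text \<open>This is \<open>(\<psi> r / r) ^ (n - 1) * u' r / r\<close>, written as
  \<open>- wint f r / r ^ n\<close> so that its derivative involves no derivative of
  \<open>\<psi>\<close>. Here \<open>r * ?g' r\<close> tends to
  \<open>- f 0 + f 0 = 0\<close>.\<close>

lemma flux_coefficient:
  assumes f: "continuous_on {0..} f"
  shows "radial_coefficient (\<lambda>r. if r = 0 then - f 0 / n else - wint f r / r ^ n)
    (\<lambda>r. - (area_density r * f r) / r ^ n + n * wint f r / r ^ (n + 1))"
    (is "radial_coefficient _ ?g'")
proof (rule radial_coefficient_patch)
  have n: "r ^ n = r ^ (n - 1) * r" for r :: real using n_ge by (intro power_minus_mult[symmetric]) simp
  show "((\<lambda>r. - wint f r / r ^ n) has_real_derivative ?g' r) (at r)" if r: "0 < r" for r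
  proof -
    have "(wint f has_real_derivative area_density r * f r) (at r)"
      using wint_has_derivative[OF f, of r] r by (simp add: at_within_halfline)
    moreover have "((\<lambda>r. r ^ n) has_real_derivative n * r ^ (n - 1)) (at r)"
      by (auto intro!: derivative_eq_intros)
    ultimately have "((\<lambda>r. - wint f r / r ^ n) has_real_derivative
        ((- (area_density r * f r)) * r ^ n - (- wint f r) * (n * r ^ (n - 1))) / (r ^ n * r ^ n)) (at r)"
      using r by (intro DERIV_divide DERIV_minus) auto
    also have "((- (area_density r * f r)) * r ^ n - (- wint f r) * (n * r ^ (n - 1))) / (r ^ n * r ^ n) = ?g' r"
      using r by (simp add: n field_simps)
    finally show ?thesis .
  qed
  show "((\<lambda>r. - wint f r / r ^ n) \<longlongrightarrow> - f 0 / n) (at_right 0)"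
    using tendsto_minus[OF wint_over_power_tendsto[OF f]] by simp
  have "\<forall>r\<in>{0<..}. r ^ n \<noteq> (0::real)" "\<forall>r\<in>{0<..}. r ^ (n + 1) \<noteq> (0::real)" by auto
  then show "continuous_on {0<..} ?g'"
    by (intro continuous_on_add continuous_on_minus continuous_on_mult
        continuous_on_divide continuous_on_const continuous_on_power continuous_on_id
        halfline_continuous_open f wint_continuous w_continuous)
  have "((\<lambda>r. - ((\<psi> r / r) ^ (n - 1) * f r) + n * (wint f r / r ^ n))
      \<longlongrightarrow> - (1 ^ (n - 1) * f 0) + n * (f 0 / n)) (at_right 0)"
    by (intro tendsto_intros halfline_tendsto_right f wint_over_power_tendsto \<psi>_over_id_tendsto)
  also have "- (1 ^ (n - 1) * f 0) + n * (f 0 / n) = 0" using n_ge by simp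
  finally show "((\<lambda>r. r * ?g' r) \<longlongrightarrow> 0) (at_right 0)"
  proof (rule Lim_transform_eventually)
    have "- ((\<psi> r / r) ^ (n - 1) * f r) + n * (wint f r / r ^ n) = r * ?g' r" if "0 < r" for r
      using that by (simp add: power_divide area_density_def n field_simps)
    then show "\<forall>\<^sub>F r in at_right 0.
        - ((\<psi> r / r) ^ (n - 1) * f r) + n * (wint f r / r ^ n) = r * ?g' r"
      by (auto simp: eventually_at_filter)
  qed
qed

section \<open>The Laplace-Beltrami operator on radial functions\<close>

lemma sqrt_det_model_metric:
  assumes "n = CARD('n::finite)" "x \<noteq> 0"
  shows "sqrt (det (model_metric \<psi> x :: real^'n^'n)) = (\<psi> (norm x) / norm x) ^ (n - 1)"
proof -
  have "0 \<le> (\<psi> (norm x) / norm x) ^ (n - 1)" using assms(2) \<psi>_pos[of "norm x"] by simp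
  moreover have "det (model_metric \<psi> x :: real^'n^'n) = ((\<psi> (norm x) / norm x) ^ (n - 1))\<^sup>2"
    by (simp only: det_model_metric[OF assms(2)] assms(1) power_mult[symmetric] mult.commute)
  ultimately show ?thesis by (metis real_sqrt_unique)
qed

text \<open>A radial gradient is fixed by the metric, hence by its inverse, so only the volume
  density appears as a factor.\<close>

lemma gradient_flux_radial:
  fixes x :: "real^'n"
  assumes n: "n = CARD('n)"
    and grad: "\<And>i x. partial_deriv i F x = g (norm x) * (x :: real^'n) $ i"
  shows "gradient_flux (model_metric \<psi>) F x = ((\<psi> (norm x) / norm x) ^ (n - 1) * g (norm x)) *\<^sub>R x"
proof (cases "x = 0")
  case True
  then have "(\<chi> j. partial_deriv j F x) = 0" by (simp add: vec_eq_iff grad)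
  then show ?thesis using True by (simp add: gradient_flux_def)
next
  case False
  have "(\<chi> j. partial_deriv j F x) = g (norm x) *\<^sub>R x" by (simp add: vec_eq_iff grad)
  moreover have "invertible (model_metric \<psi> x :: real^'n^'n)"
    using False \<psi>_pos[of "norm x"] by (simp add: invertible_det_nz det_model_metric)
  then have "matrix_inv (model_metric \<psi> x) *v x = x"
    by (rule matrix_inv_mult_fixed[OF _ model_metric_mult_self])
  ultimately show ?thesis
    using sqrt_det_model_metric[OF n False] by (simp add: gradient_flux_def matrix_vector_mult_scaleR)
qed

lemma radial_Poisson:
  assumes n: "n = CARD('n::finite)" and f: "continuous_on {0..} f"
    and u: "\<And>r. 0 \<le> r \<Longrightarrow> (u has_real_derivative - wavg f r) (at r within {0..})"
  defines "U \<equiv> \<lambda>x::real^'n. u (norm x)"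
  shows "classical_domain (model_metric \<psi>) U" and "- Laplace_Beltrami (model_metric \<psi>) U x = f (norm x)"
proof -
  define g where "g r = (if r = 0 then - f 0 / n else - wavg f r / r)" for r
  define g' where "g' r = - (f r - wavg f r * ((real n - 1) * \<psi>' r / \<psi> r)) / r + wavg f r / r\<^sup>2" for r
  define h where "h r = (if r = 0 then - f 0 / n else - wint f r / r ^ n)" for r
  define h' where "h' r = - (area_density r * f r) / r ^ n + n * wint f r / r ^ (n + 1)" for r
  interpret g: radial_coefficient g g'
    using gradient_coefficient[OF f] by (simp add: g_def[abs_def] g'_def[abs_def])
  interpret h: radial_coefficient h h'
    using flux_coefficient[OF f] by (simp add: h_def[abs_def] h'_def[abs_def])
  have u': "(u has_real_derivative r * g r) (at r within {0..})" if "0 \<le> r" for r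
    using u[OF that] by (auto simp: g_def wavg_0 split: if_splits)
  have pow: "r ^ n = r ^ (n - 1) * r" for r :: real using n_ge by (intro power_minus_mult[symmetric]) simp
  have flux: "(\<lambda>y. gradient_flux (model_metric \<psi>) U y $ i) = (\<lambda>y. h (norm y) * y $ i)" for i
  proof
    fix y :: "real^'n"
    have "gradient_flux (model_metric \<psi>) U y $ i = (\<psi> (norm y) / norm y) ^ (n - 1) * g (norm y) * y $ i"
      unfolding U_def by (subst gradient_flux_radial[OF n, of _ g]) (simp_all add: g.radial_gradient[OF u'])
    also have "\<dots> = h (norm y) * y $ i"
    proof (cases "y = 0")
      case False
      then show ?thesis
        using \<psi>_pos[of "norm y"]
        by (simp add: g_def h_def wavg_def power_divide area_density_def pow field_simps)
    qed simp
    finally show "gradient_flux (model_metric \<psi>) U y $ i = h (norm y) * y $ i" .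
  qed
  show "classical_domain (model_metric \<psi>) U"
    unfolding classical_domain_def flux using h.C1_component g.radial_C2[OF u'] by (auto simp: U_def)
  have "(\<Sum>i\<in>UNIV. partial_deriv i (\<lambda>y. gradient_flux (model_metric \<psi>) U y $ i) x)
      = n * h (norm x) + norm x * h' (norm x)"
    unfolding flux h.divergence n ..
  \<comment> \<open>Off the pole the two terms with \<open>wint f\<close> cancel and leave
    \<open>- area_density r * f r / r ^ (n - 1)\<close> at \<open>r = norm x\<close>. At the pole
    the density is \<open>1\<close> and \<open>n * h 0 = - f 0\<close>.\<close>
  also have "\<dots> = - sqrt (det (model_metric \<psi> x)) * f (norm x)"
  proof (cases "x = 0")
    case True
    then show ?thesis using n_ge by (simp add: h_def model_metric_def)
  next
    case False
    then show ?thesis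
      by (simp add: sqrt_det_model_metric[OF n] h_def h'_def power_divide area_density_def pow field_simps)
  qed
  moreover have "sqrt (det (model_metric \<psi> x)) \<noteq> 0"
  proof (cases "x = 0")
    case False
    then show ?thesis
      unfolding sqrt_det_model_metric[OF n False] using \<psi>_pos[of "norm x"] by simp
  qed (simp add: model_metric_def)
  ultimately show "- Laplace_Beltrami (model_metric \<psi>) U x = f (norm x)"
    by (simp add: Laplace_Beltrami_def)
qed

lemma truncated_solution_imp_Lane_Emden:
  assumes n: "n = CARD('n::finite)" and pq: "0 < p" "0 < q"
    and sol: "truncated_solution p q \<xi> \<eta> u v"
    and pos: "\<And>r. 0 \<le> r \<Longrightarrow> 0 < u r \<and> 0 < v r"
  shows "Lane_Emden_solution (model_metric \<psi> :: real^'n \<Rightarrow> real^'n^'n) p q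
    (\<lambda>x. u (norm x)) (\<lambda>x. v (norm x))"
proof -
  have swap: "truncated_solution q p \<eta> \<xi> v u" using sol truncated_solution_swap by blast
  have "continuous_on {0..} u" "continuous_on {0..} v"
    using sol by (auto simp: truncated_solution_def)
  then have f: "continuous_on {0..} (\<lambda>s. pos_powr q (v s))" "continuous_on {0..} (\<lambda>s. pos_powr p (u s))"
    by (auto intro: continuous_on_pos_powr pq)
  have eq: "pos_powr q (v (norm x)) = v (norm x) powr q" "pos_powr p (u (norm x)) = u (norm x) powr p"
    for x :: "real^'n" using pos[of "norm x"] by (simp_all add: pos_powr_def)
  note U = radial_Poisson[OF n f(1) truncated_solution_has_derivative[OF pq(2) sol]]
  note V = radial_Poisson[OF n f(2) truncated_solution_has_derivative[OF pq(1) swap]]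
  show ?thesis
    unfolding Lane_Emden_solution_def using U V pos by (simp add: eq)
qed

end

theorem proposition3p4:
  fixes \<psi> :: "real \<Rightarrow> real" and p q :: real and n :: nat
  assumes "n = CARD('n::finite)" and "n \<ge> 3"
    and "Cartan_Hadamard_model \<psi>"
    and "p > 0" and "q > 0"
    and "1 / (p + 1) + 1 / (q + 1) \<le> (real n - 2) / real n"
  shows "(\<forall>\<xi>>0. \<exists>\<eta>>0. \<exists>u v. globally_positive_solution n \<psi> p q \<xi> \<eta> u v) \<and>
    (\<exists>U V :: real \<Rightarrow> real^'n \<Rightarrow> real. \<forall>\<xi>>0.
       Lane_Emden_solution (model_metric \<psi>) p q (U \<xi>) (V \<xi>) \<and> U \<xi> 0 = \<xi> \<and>
       (\<exists>\<eta>>0. \<exists>u v. globally_positive_solution n \<psi> p q \<xi> \<eta> u v \<and>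
          (\<forall>x. U \<xi> x = u (norm x) \<and> V \<xi> x = v (norm x))))"
proof -
  obtain \<psi>' where \<psi>': "C1_halfline \<psi> \<psi>'" "\<psi>' 0 = 1"
    using assms(3) by (auto simp: Cartan_Hadamard_model_def model_function_def)
  interpret convex_profile \<psi> \<psi>' n
    using assms(2,3) \<psi>' by unfold_locales (auto simp: Cartan_Hadamard_model_def model_function_def)
  \<comment> \<open>The functions are quantified before \<open>\<eta>\<close>, so that choice yields
    families of functions indexed by \<open>\<xi>\<close> alone.\<close>
  have "\<exists>u v. \<exists>\<eta>>0. globally_positive_solution n \<psi> p q \<xi> \<eta> u v \<and> u 0 = \<xi> \<and>
      Lane_Emden_solution (model_metric \<psi> :: real^'n \<Rightarrow> real^'n^'n) p q
        (\<lambda>x. u (norm x)) (\<lambda>x. v (norm x))"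
    if "0 < \<xi>" for \<xi>
  proof -
    have "\<exists>\<eta>>0. \<exists>u v. truncated_solution p q \<xi> \<eta> u v \<and> (\<forall>r\<ge>0. 0 < u r \<and> 0 < v r)"
      by (rule positive_solution_exists[OF assms(4,5) that], rule no_common_zero[OF assms(4,5) that _ assms(6)])
    then obtain \<eta> u v where "0 < \<eta>" and sol: "truncated_solution p q \<xi> \<eta> u v"
      and pos: "\<And>r. 0 \<le> r \<Longrightarrow> 0 < u r \<and> 0 < v r"
      by blast
    show ?thesis
      using \<open>0 < \<eta>\<close> truncated_solution_imp_CP[OF assms(4,5) sol pos] truncated_solution_0(1)[OF sol]
        truncated_solution_imp_Lane_Emden[OF assms(1,4,5) sol pos]
      by blast
  qed
  then obtain u v where uv: "\<And>\<xi>. 0 < \<xi> \<Longrightarrow>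
      (\<exists>\<eta>>0. globally_positive_solution n \<psi> p q \<xi> \<eta> (u \<xi>) (v \<xi>)) \<and> u \<xi> 0 = \<xi> \<and>
      Lane_Emden_solution (model_metric \<psi> :: real^'n \<Rightarrow> real^'n^'n) p q
        (\<lambda>x. u \<xi> (norm x)) (\<lambda>x. v \<xi> (norm x))"
    by metis
  show ?thesis
  proof (rule conjI, use uv in blast,
      rule exI[of _ "\<lambda>\<xi> x. u \<xi> (norm x)"], rule exI[of _ "\<lambda>\<xi> x. v \<xi> (norm x)"],
      intro allI impI conjI)
    fix \<xi> :: real assume "0 < \<xi>"
    note uv = uv[OF this]
    show "Lane_Emden_solution (model_metric \<psi> :: real^'n \<Rightarrow> real^'n^'n) p q
        (\<lambda>x. u \<xi> (norm x)) (\<lambda>x. v \<xi> (norm x))"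
      using uv by blast
    show "u \<xi> (norm (0 :: real^'n)) = \<xi>" using uv by simp
    show "\<exists>\<eta>>0. \<exists>u' v'. globally_positive_solution n \<psi> p q \<xi> \<eta> u' v' \<and>
        (\<forall>x :: real^'n. u \<xi> (norm x) = u' (norm x) \<and> v \<xi> (norm x) = v' (norm x))"
      using uv by blast
  qed
qed

end
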